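(* Let $u\in H^{1,a}(B_1^+)$, $u\not\equiv0$, be the unique solution of the boundary value problem with datum $g$ described in the context, and let $k:=\lim_{r\to0^+}\tilde{\mathcal{N}}(r)\in[0,\infty)$. Then the limit of $\mathcal{N}(r)$ as $r\to0^+$ exists and $\lim_{r\to0^+}\mathcal{N}(r)=k$.
   Context: Fix an integer $N\ge1$, $a\in(-1,1)$, $p\ge2$ and constants $\lambda_-,\lambda_+\ge0$. Write $t^+=\max\{t,0\}$, $t^-=\max\{-t,0\}$, $z=(x,y)\in\mathbb{R}^N\times\mathbb{R}$, $\mathbb{R}^{N+1}_+=\mathbb{R}^N\times(0,\infty)$, $B_r^+=\{z\in\mathbb{R}^{N+1}_+:|z|<r\}$, $S_r^+=\{z\in\mathbb{R}^{N+1}_+:|z|=r\}$, $B_r'=\{x\in\mathbb{R}^N:|x|<r\}$ (identified with $B_r'\times\{0\}$). $H^{1,a}(B_r^+)$ is the completion of $C^\infty(\overline{B_r^+})$ in the norm $\left(\int_{B_r^+}y^a(|\nabla u|^2+u^2)\,dx\,dy\right)^{1/2}$, and $H^{1,a}_{0,S_r^+}(B_r^+)$ is the closure of $C_c^\infty(\overline{B_r^+}\setminus\overline{S_r^+})$ in it. Given $g\in H^{1,a}(B_1^+)\cap C(\overline{B_1^+})$, a solution of $$-\mathrm{div}(y^a\nabla u)=0\text{ in }B_1^+,\quad u=g\text{ on }S_1^+,\quad -\lim_{y\to0^+}y^a\partial_yu=\lambda_-(u^-)^{p-1}-\lambda_+(u^+)^{p-1}\text{ on }B_1'$$ is a function $u\in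 H^{1,a}(B_1^+)\cap L^p(B_1')$ (in the sense of traces on $B_1'$) with $u-g\in H^{1,a}_{0,S_1^+}(B_1^+)$ and $\int_{B_1^+}y^a\nabla u\cdot\nabla\varphi\,dx\,dy=\int_{B_1'}(\lambda_-(u^-)^{p-1}-\lambda_+(u^+)^{p-1})\varphi\,dx$ for all $\varphi\in H^{1,a}_{0,S_1^+}(B_1^+)$. The solution exists, is unique, and is bounded and continuous on $B_1^+\cup B_1'$. For small $r>0$ set $D(r)=r^{-(N+a-1)}\int_{B_r^+}y^a|\nabla u|^2\,dx\,dy$, $H(r)=r^{-(N+a)}\int_{S_r^+}y^au^2\,dS$, $G(r)=r^{-(N+a-1)}\int_{B_r'}(\lambda_-(u^-)^p+\lambda_+(u^+)^p)\,dx$. The frequency function is $\mathcal{N}(r)=D(r)/H(r)$ and the perturbed frequency function is $\tilde{\mathcal{N}}(r)=\left(D(r)+\frac2pG(r)\right)/H(r)$. (For $u\not\equiv0$, $H(r)>0$ for small $r$; $\tilde{\mathcal{N}}$ is nondecreasing for small $r$, so its limit $k$ at $0^+$ exists and is finite.) *)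

theory Defs
  imports "HOL-Analysis.Analysis"
begin

text \<open>
  Points of the half-space are pairs \<open>z = (x, y)\<close> of type \<open>(real ^ 'n) \<times> real\<close>, with the Euclidean norm
  of the product type; \<open>N = CARD('n)\<close>.
\<close>

definition half_ball :: "real \<Rightarrow> ((real ^ 'n) \<times> real) set" where
  "half_ball r = {z. 0 < snd z \<and> norm z < r}"

definition half_sphere :: "real \<Rightarrow> ((real ^ 'n) \<times> real) set" where
  "half_sphere r = {z. 0 < snd z \<and> norm z = r}"

definition pos_part :: "real \<Rightarrow> real" where
  "pos_part t = max t 0"

definition neg_part :: "real \<Rightarrow> real" where
  "neg_part t = max (- t) 0"

text \<open>Meaningful at points of differentiability only.\<close>

definition grad :: "('a::real_inner \<Rightarrow> real) \<Rightarrow> 'a \<Rightarrow> 'a" where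
  "grad f x = (THE D. GDERIV f x :> D)"

primrec Ck :: "nat \<Rightarrow> ('a::real_normed_vector \<Rightarrow> real) \<Rightarrow> bool" where
  "Ck 0 f \<longleftrightarrow> continuous_on UNIV f"
| "Ck (Suc k) f \<longleftrightarrow>
     (\<forall>x. f differentiable (at x)) \<and> (\<forall>v. Ck k (\<lambda>x. frechet_derivative f (at x) v))"

definition smooth :: "('a::real_normed_vector \<Rightarrow> real) \<Rightarrow> bool" where
  "smooth f \<longleftrightarrow> (\<forall>k. Ck k f)"


subsection \<open>Weighted Sobolev spaces on half-balls\<close>

text \<open>The squared weighted norm of a pair (function, gradient), possibly infinite.\<close>

definition H1a_sqnorm ::
  "real \<Rightarrow> real \<Rightarrow> ((real ^ 'n) \<times> real \<Rightarrow> real) \<Rightarrow> ((real ^ 'n) \<times> real \<Rightarrow> (real ^ 'n) \<times> real) \<Rightarrow> ennreal" where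
  "H1a_sqnorm a r u V =
     (\<integral>\<^sup>+ z \<in> half_ball r. ennreal (snd z powr a * ((norm (V z))\<^sup>2 + (u z)\<^sup>2)) \<partial>lborel)"

text \<open>
  Functions that are smooth up to the boundary of the half-ball are represented as restrictions of
  smooth functions on the whole space. The map from \<open>f\<close> to \<open>(f, grad f)\<close> embeds them
  isometrically into a weighted \<open>L\<^sup>2\<close> space of pairs, so the completion is the closure of the image: an
  element of the completion is a pair \<open>(u, V)\<close>, up to equality almost everywhere, which is the limit
  of such pairs. Since \<open>\<bar>a\<bar> < 1\<close>, both \<open>y\<^sup>a\<close> and its reciprocal are locally integrable, so
  \<open>V\<close> is the distributional gradient of \<open>u\<close> and is determined by \<open>u\<close> almost everywhere.
\<close>

definition H1a_limit ::
  "real \<Rightarrow> real \<Rightarrow> (nat \<Rightarrow> (real ^ 'n) \<times> real \<Rightarrow> real) \<Rightarrow>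
    ((real ^ 'n) \<times> real \<Rightarrow> real) \<Rightarrow> ((real ^ 'n) \<times> real \<Rightarrow> (real ^ 'n) \<times> real) \<Rightarrow> bool" where
  "H1a_limit a r f u V \<longleftrightarrow>
     (\<forall>n. smooth (f n)) \<and>
     set_borel_measurable lborel (half_ball r) u \<and>
     set_borel_measurable lborel (half_ball r) V \<and>
     (\<lambda>n. H1a_sqnorm a r (\<lambda>z. f n z - u z) (\<lambda>z. grad (f n) z - V z)) \<longlonglongrightarrow> 0"

definition has_H1a_gradient ::
  "real \<Rightarrow> real \<Rightarrow> ((real ^ 'n) \<times> real \<Rightarrow> real) \<Rightarrow> ((real ^ 'n) \<times> real \<Rightarrow> (real ^ 'n) \<times> real) \<Rightarrow> bool" where
  "has_H1a_gradient a r u V \<longleftrightarrow> (\<exists>f. H1a_limit a r f u V)"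

definition H1a :: "real \<Rightarrow> real \<Rightarrow> ((real ^ 'n) \<times> real \<Rightarrow> real) set" where
  "H1a a r = {u. \<exists>V. has_H1a_gradient a r u V}"

text \<open>The approximating functions have compact support in the closed half-ball minus the closed
  half-sphere; they need not vanish on the flat part of the boundary.\<close>

definition H1a_0S :: "real \<Rightarrow> real \<Rightarrow> ((real ^ 'n) \<times> real \<Rightarrow> real) set" where
  "H1a_0S a r =
     {u. \<exists>V f. H1a_limit a r f u V \<and>
           (\<forall>n. \<exists>K. compact K \<and> K \<subseteq> closure (half_ball r) - closure (half_sphere r) \<and>
                 (\<forall>z \<in> closure (half_ball r) - K. f n z = 0))}"

text \<open>The trace on the flat part is the continuous extension to \<open>H\<^sup>1\<^sup>,\<^sup>a\<close> of the restriction map,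
  with values in \<open>L\<^sup>2\<close>.\<close>

definition has_trace ::
  "real \<Rightarrow> real \<Rightarrow> ((real ^ 'n) \<times> real \<Rightarrow> real) \<Rightarrow> (real ^ 'n \<Rightarrow> real) \<Rightarrow> bool" where
  "has_trace a r u T \<longleftrightarrow>
     set_borel_measurable lborel (ball 0 r) T \<and>
     (\<exists>f V. H1a_limit a r f u V \<and>
        (\<lambda>n. \<integral>\<^sup>+ x \<in> ball 0 r. ennreal ((f n (x, 0) - T x)\<^sup>2) \<partial>lborel) \<longlonglongrightarrow> 0)"


subsection \<open>The boundary value problem\<close>

text \<open>
  The integrability requirement in the last clause makes explicit that the right-hand side of the
  weak equation is meant to exist (a non-integrable function has Bochner integral 0). It is automatic
  for bounded \<open>u\<close>.
\<close>

definition is_solution ::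
  "real \<Rightarrow> real \<Rightarrow> real \<Rightarrow> real \<Rightarrow> ((real ^ 'n) \<times> real \<Rightarrow> real) \<Rightarrow>
    ((real ^ 'n) \<times> real \<Rightarrow> real) \<Rightarrow> ((real ^ 'n) \<times> real \<Rightarrow> (real ^ 'n) \<times> real) \<Rightarrow> bool" where
  "is_solution a p lm lp g u Du \<longleftrightarrow>
     has_H1a_gradient a 1 u Du \<and>
     (\<lambda>z. u z - g z) \<in> H1a_0S a 1 \<and>
     (\<exists>T. has_trace a 1 u T \<and>
        set_integrable lborel (ball 0 1) (\<lambda>x. \<bar>T x\<bar> powr p) \<and>
        (\<forall>\<phi> D\<phi> T\<phi>. \<phi> \<in> H1a_0S a 1 \<and> has_H1a_gradient a 1 \<phi> D\<phi> \<and> has_trace a 1 \<phi> T\<phi> \<longrightarrow>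
           (let h = (\<lambda>x. (lm * neg_part (T x) powr (p - 1) - lp * pos_part (T x) powr (p - 1)) * T\<phi> x)
            in set_integrable lborel (ball 0 1) h \<and>
               (LINT z:half_ball 1|lborel. snd z powr a * (Du z \<bullet> D\<phi> z)) =
               (LINT x:ball 0 1|lborel. h x))))"


subsection \<open>Frequency functions\<close>

text \<open>
  The half-sphere of radius \<open>r\<close> is the graph of \<open>x \<mapsto> sqrt (r\<^sup>2 - \<bar>x\<bar>\<^sup>2)\<close> over the open ball of
  radius \<open>r\<close>, so surface integrals over it are graph integrals with the usual area element.
\<close>

definition graph_integral ::
  "(real ^ 'n) set \<Rightarrow> (real ^ 'n \<Rightarrow> real) \<Rightarrow> ((real ^ 'n) \<times> real \<Rightarrow> real) \<Rightarrow> real" where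
  "graph_integral U h f = (LINT x:U|lborel. f (x, h x) * sqrt (1 + (norm (grad h x))\<^sup>2))"

definition half_sphere_integral :: "real \<Rightarrow> ((real ^ 'n) \<times> real \<Rightarrow> real) \<Rightarrow> real" where
  "half_sphere_integral r f = graph_integral (ball 0 r) (\<lambda>x. sqrt (r\<^sup>2 - (norm x)\<^sup>2)) f"

definition D_fun :: "real \<Rightarrow> ((real ^ 'n) \<times> real \<Rightarrow> (real ^ 'n) \<times> real) \<Rightarrow> real \<Rightarrow> real" where
  "D_fun a Du r =
     r powr (- (real CARD('n) + a - 1)) * (LINT z:half_ball r|lborel. snd z powr a * (norm (Du z))\<^sup>2)"

definition H_fun :: "real \<Rightarrow> ((real ^ 'n) \<times> real \<Rightarrow> real) \<Rightarrow> real \<Rightarrow> real" where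
  "H_fun a u r =
     r powr (- (real CARD('n) + a)) * half_sphere_integral r (\<lambda>z. snd z powr a * (u z)\<^sup>2)"

definition G_fun :: "real \<Rightarrow> real \<Rightarrow> real \<Rightarrow> real \<Rightarrow> ((real ^ 'n) \<times> real \<Rightarrow> real) \<Rightarrow> real \<Rightarrow> real" where
  "G_fun a p lm lp u r =
     r powr (- (real CARD('n) + a - 1)) *
     (LINT x:ball 0 r|lborel. lm * neg_part (u (x, 0)) powr p + lp * pos_part (u (x, 0)) powr p)"

definition frequency ::
  "real \<Rightarrow> ((real ^ 'n) \<times> real \<Rightarrow> real) \<Rightarrow> ((real ^ 'n) \<times> real \<Rightarrow> (real ^ 'n) \<times> real) \<Rightarrow> real \<Rightarrow> real" where
  "frequency a u Du r = D_fun a Du r / H_fun a u r"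

definition perturbed_frequency ::
  "real \<Rightarrow> real \<Rightarrow> real \<Rightarrow> real \<Rightarrow> ((real ^ 'n) \<times> real \<Rightarrow> real) \<Rightarrow>
    ((real ^ 'n) \<times> real \<Rightarrow> (real ^ 'n) \<times> real) \<Rightarrow> real \<Rightarrow> real" where
  "perturbed_frequency a p lm lp u Du r =
     (D_fun a Du r + 2 / p * G_fun a p lm lp u r) / H_fun a u r"

end

theory Submission
  imports Defs
begin

text \<open>
  The two frequency functions differ by \<open>2 / p * G / H\<close>, so it suffices that \<open>G / H\<close> tends to \<open>0\<close>.
  Near the origin \<open>u\<close> is bounded and \<open>p \<ge> 2\<close>, so \<open>G\<close> is controlled by the integral of \<open>u(x, 0)\<^sup>2\<close> over
  the flat part. The fundamental theorem of calculus on the vertical segment from \<open>(x, 0)\<close> to the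
  half-sphere and the Cauchy-Schwarz inequality with weight \<open>y\<^sup>a\<close> bound this by the integral over the
  half-sphere and the Dirichlet energy, which gives \<open>G(r) \<le> C r\<^sup>1\<^sup>-\<^sup>a (H(r) + D(r))\<close>. Since the perturbed
  frequency converges, it is bounded, and \<open>G / H\<close> is of order \<open>r\<^sup>1\<^sup>-\<^sup>a\<close>.
\<close>

section \<open>One-dimensional weighted estimates on a vertical segment\<close>

lemma nn_integral_powr_Ioo:
  fixes b h :: real
  assumes "-1 < b" "0 \<le> h"
  shows "(\<integral>\<^sup>+y \<in> {0<..<h}. ennreal (y powr b) \<partial>lborel) = ennreal (h powr (b + 1) / (b + 1))"
proof -
  have "((\<lambda>y. y powr b) has_integral h powr (b + 1) / (b + 1)) {0..h}"
    by (rule has_integral_powr_from_0) (use assms in auto)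
  then have "((\<lambda>y. indicator {0<..<h} y * y powr b) has_integral h powr (b + 1) / (b + 1)) UNIV"
    by (subst (asm) has_integral_restrict_UNIV[symmetric], subst has_integral_spike_finite_eq[of "{0, h}"])
      (auto simp: indicator_def)
  then have "(\<integral>\<^sup>+y. ennreal (indicator {0<..<h} y * y powr b) \<partial>lborel) = ennreal (h powr (b + 1) / (b + 1))"
    by (intro nn_integral_has_integral_lborel) auto
  then show ?thesis
    by (auto simp: ennreal_mult' ennreal_indicator mult.commute)
qed

text \<open>Along a subsequence whose integrals stay below \<open>(1/2)^n\<close>, the integral of
  the series of all terms is finite. Hence the series converges at almost every point, and its terms
  tend to 0 there.\<close>

lemma nn_integral_tendsto_0_AE_subseq:
  fixes F :: "nat \<Rightarrow> 'a \<Rightarrow> ennreal"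
  assumes [measurable]: "\<And>n. F n \<in> borel_measurable M"
    and lim: "(\<lambda>n. \<integral>\<^sup>+x. F n x \<partial>M) \<longlonglongrightarrow> 0"
  obtains s where "strict_mono s" "AE x in M. (\<lambda>n. F (s n) x) \<longlonglongrightarrow> 0"
proof -
  have "\<exists>N. \<forall>m\<ge>N. (\<integral>\<^sup>+x. F m x \<partial>M) < ennreal ((1/2)^n)" for n
    using order_tendstoD(2)[OF lim, of "ennreal ((1/2)^n)"] by (simp add: eventually_sequentially)
  then obtain N where N: "\<And>n m. m \<ge> N n \<Longrightarrow> (\<integral>\<^sup>+x. F m x \<partial>M) < ennreal ((1/2)^n)"
    by metis
  \<comment> \<open>The sum makes \<open>s n\<close> at least \<open>N n\<close>; the added
    \<open>n\<close> makes \<open>s\<close> strictly increasing.\<close>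
  define s where "s n = (\<Sum>i\<le>n. N i) + n" for n
  have "strict_mono s" by (auto simp: strict_mono_Suc_iff s_def)
  have "N n \<le> s n" for n
    by (auto simp: s_def intro!: trans_le_add1 member_le_sum)
  then have s: "(\<integral>\<^sup>+x. F (s n) x \<partial>M) < ennreal ((1/2)^n)" for n
    by (rule N)
  have "(\<integral>\<^sup>+x. (\<Sum>n. F (s n) x) \<partial>M) = (\<Sum>n. \<integral>\<^sup>+x. F (s n) x \<partial>M)"
    by (rule nn_integral_suminf) measurable
  also have "\<dots> \<le> (\<Sum>n. ennreal ((1/2)^n))"
    by (intro suminf_le) (auto intro: less_imp_le s)
  also have "\<dots> = ennreal (\<Sum>n. (1/2)^n)"
    by (intro suminf_ennreal2) (auto intro!: summable_geometric)
  finally have "(\<integral>\<^sup>+x. (\<Sum>n. F (s n) x) \<partial>M) \<noteq> \<infinity>"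
    by (auto simp: top_unique)
  then have "AE x in M. (\<Sum>n. F (s n) x) \<noteq> \<infinity>"
    by (intro nn_integral_PInf_AE) measurable
  then have "AE x in M. (\<lambda>n. F (s n) x) \<longlonglongrightarrow> 0"
  proof eventually_elim
    case (elim x)
    define c where "c n = enn2real (F (s n) x)" for n
    have fin: "F (s n) x \<noteq> \<infinity>" for n
    proof
      assume "F (s n) x = \<infinity>"
      then have "\<infinity> \<le> (\<Sum>n. F (s n) x)"
        using sum_le_suminf[of "\<lambda>n. F (s n) x" "{n}"] by simp
      with elim show False by (simp add: top_unique)
    qed
    have F: "F (s n) x = ennreal (c n)" for n
      using fin[of n] by (simp add: c_def less_top)
    have "summable c"
    proof (rule summable_suminf_not_top)
      show "(\<Sum>n. ennreal (c n)) \<noteq> top" using elim by (simp add: F[symmetric])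
    qed (simp add: c_def)
    then have "c \<longlonglongrightarrow> 0" by (rule summable_LIMSEQ_zero)
    then have "(\<lambda>n. ennreal (c n)) \<longlonglongrightarrow> ennreal 0" by (intro tendsto_ennrealI)
    then show ?case by (simp add: F)
  qed
  with \<open>strict_mono s\<close> that show ?thesis by blast
qed

text \<open>The increment is the integral of the derivative. Splitting the factor 1 as
  \<open>y powr (-a/2) * y powr (a/2)\<close> and applying Cauchy-Schwarz separates the integral of
  \<open>y powr (-a)\<close>, which is finite because \<open>a < 1\<close>, from the weighted
  energy. Integrating over all of \<open>{0<..<h}\<close> makes the bound uniform in
  \<open>s\<close> and \<open>t\<close>.\<close>

lemma weighted_increment_bound:
  fixes \<phi> \<phi>' :: "real \<Rightarrow> real"
  assumes "a < 1" "0 < s" "s \<le> t" "t < h"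
    and d: "\<And>y. (\<phi> has_real_derivative \<phi>' y) (at y)"
    and c: "continuous_on UNIV \<phi>'"
  shows "ennreal ((\<phi> t - \<phi> s)\<^sup>2) \<le> ennreal (h powr (1 - a) / (1 - a)) *
           (\<integral>\<^sup>+y \<in> {0<..<h}. ennreal (y powr a * (\<phi>' y)\<^sup>2) \<partial>lborel)"
proof -
  have [measurable]: "\<phi>' \<in> borel_measurable borel"
    using c by (rule borel_measurable_continuous_onI)
  have "has_bochner_integral lborel (\<lambda>y. \<phi>' y * indicator {s..t} y) (\<phi> t - \<phi> s)"
    using c d by (intro has_bochner_integral_FTC_Icc_real assms(3))
      (auto simp: continuous_on_eq_continuous_at)
  then have I: "\<phi> t - \<phi> s = (\<integral>y. \<phi>' y * indicator {s..t} y \<partial>lborel)"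
    and i: "integrable lborel (\<lambda>y. \<phi>' y * indicator {s..t} y)"
    by (auto simp: has_bochner_integral_iff)
  have "ennreal \<bar>\<phi> t - \<phi> s\<bar> \<le> (\<integral>\<^sup>+y. ennreal (norm (\<phi>' y * indicator {s..t} y)) \<partial>lborel)"
    unfolding I using integral_norm_bound_ennreal[OF i] by simp
  also have "\<dots> \<le> (\<integral>\<^sup>+y. (ennreal (y powr (-a/2)) * indicator {0<..<h} y) *
      (ennreal (y powr (a/2) * \<bar>\<phi>' y\<bar>) * indicator {0<..<h} y) \<partial>lborel)"
  proof (rule nn_integral_mono)
    fix y
    have *: "y powr - (a/2) * (y powr (a/2) * c) = c" if "0 < y" for c
      using that by (simp add: mult.assoc[symmetric] powr_add[symmetric])
    then show "ennreal (norm (\<phi>' y * indicator {s..t} y)) \<le> (ennreal (y powr (-a/2)) * indicator {0<..<h} y) *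
      (ennreal (y powr (a/2) * \<bar>\<phi>' y\<bar>) * indicator {0<..<h} y)"
      using assms(2,4) by (cases "s \<le> y \<and> y \<le> t") (auto simp: indicator_def * simp flip: ennreal_mult)
  qed
  finally have "(ennreal \<bar>\<phi> t - \<phi> s\<bar>)\<^sup>2 \<le> (\<integral>\<^sup>+y. (ennreal (y powr (-a/2)) * indicator {0<..<h} y) *
      (ennreal (y powr (a/2) * \<bar>\<phi>' y\<bar>) * indicator {0<..<h} y) \<partial>lborel)\<^sup>2"
    by (intro power_mono) auto
  also have "\<dots> \<le> (\<integral>\<^sup>+y. (ennreal (y powr (-a/2)) * indicator {0<..<h} y)\<^sup>2 \<partial>lborel) *
      (\<integral>\<^sup>+y. (ennreal (y powr (a/2) * \<bar>\<phi>' y\<bar>) * indicator {0<..<h} y)\<^sup>2 \<partial>lborel)"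
    by (rule Cauchy_Schwarz_nn_integral) measurable
  also have "(\<integral>\<^sup>+y. (ennreal (y powr (-a/2)) * indicator {0<..<h} y)\<^sup>2 \<partial>lborel) =
      (\<integral>\<^sup>+y \<in> {0<..<h}. ennreal (y powr (-a)) \<partial>lborel)"
    by (intro nn_integral_cong)
      (auto simp: indicator_def ennreal_power power2_eq_square powr_add[symmetric] simp flip: ennreal_mult)
  also have "\<dots> = ennreal (h powr (-a + 1) / (-a + 1))"
    by (rule nn_integral_powr_Ioo) (use assms in auto)
  also have "(\<integral>\<^sup>+y. (ennreal (y powr (a/2) * \<bar>\<phi>' y\<bar>) * indicator {0<..<h} y)\<^sup>2 \<partial>lborel) =
      (\<integral>\<^sup>+y \<in> {0<..<h}. ennreal (y powr a * (\<phi>' y)\<^sup>2) \<partial>lborel)"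
  proof (intro nn_integral_cong)
    fix y :: real
    have "(y powr (a/2) * \<bar>\<phi>' y\<bar>)\<^sup>2 = y powr a * (\<phi>' y)\<^sup>2"
      by (simp add: power_mult_distrib) (simp add: power2_eq_square powr_add[symmetric])
    then show "(ennreal (y powr (a/2) * \<bar>\<phi>' y\<bar>) * indicator {0<..<h} y)\<^sup>2 =
        ennreal (y powr a * (\<phi>' y)\<^sup>2) * indicator {0<..<h} y"
      by (auto simp: indicator_def ennreal_power)
  qed
  finally show ?thesis
    by (simp add: ennreal_power add.commute)
qed

text \<open>The increment bound holds for the smooth \<open>\<phi> n\<close> and passes to the limit
  at almost every pair of points; continuity of \<open>v\<close> then carries it to the endpoints
  \<open>0\<close> and \<open>h\<close>. The function \<open>w\<close> stands for the weak
  derivative of \<open>v\<close> along the segment. The constant 4 is the product of two factors 2: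
  one from comparing \<open>\<phi>' n\<close> with \<open>w\<close>, one from comparing
  \<open>v 0\<close> with \<open>v h\<close>.\<close>

lemma weighted_trace_on_segment:
  fixes v w :: "real \<Rightarrow> real" and \<phi> \<phi>' :: "nat \<Rightarrow> real \<Rightarrow> real"
  assumes "a < 1" "0 < h"
    and d: "\<And>n y. (\<phi> n has_real_derivative \<phi>' n y) (at y)"
    and c: "\<And>n. continuous_on UNIV (\<phi>' n)"
    and v: "continuous_on {0..h} v" and w[measurable]: "w \<in> borel_measurable borel"
    and lim: "(\<lambda>n. \<integral>\<^sup>+y \<in> {0<..<h}. ennreal (y powr a * ((\<phi>' n y - w y)\<^sup>2 + (\<phi> n y - v y)\<^sup>2)) \<partial>lborel) \<longlonglongrightarrow> 0"
  shows "ennreal ((v 0)\<^sup>2) \<le> ennreal (2 * (v h)\<^sup>2) + ennreal (4 * h powr (1 - a) / (1 - a)) *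
           (\<integral>\<^sup>+y \<in> {0<..<h}. ennreal (y powr a * (w y)\<^sup>2) \<partial>lborel)"
proof -
  define W where "W = h powr (1 - a) / (1 - a)"
  define E where "E = (\<integral>\<^sup>+y \<in> {0<..<h}. ennreal (y powr a * (w y)\<^sup>2) \<partial>lborel)"
  define F where "F n y = ennreal (y powr a * ((\<phi>' n y - w y)\<^sup>2 + (\<phi> n y - v y)\<^sup>2)) * indicator {0<..<h} y" for n y
  have "W > 0" using assms by (simp add: W_def)
  have [measurable]: "\<phi> n \<in> borel_measurable borel" "\<phi>' n \<in> borel_measurable borel" for n
    using c[of n] d[of n] by (auto intro!: borel_measurable_continuous_onI DERIV_continuous_on)
  \<comment> \<open>Nothing is known of \<open>v\<close> outside \<open>{0..h}\<close>, so it is cut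
    off by the indicator before measurability is claimed.\<close>
  have [measurable]: "(\<lambda>y. v y * indicator {0<..<h} y) \<in> borel_measurable borel"
    using borel_measurable_continuous_on_indicator[OF _ continuous_on_subset[OF v], of "{0<..<h}"]
    by (simp add: subset_eq mult.commute)
  have F_eq: "F n y = ennreal (y powr a * ((\<phi>' n y - w y)\<^sup>2 + (\<phi> n y - v y * indicator {0<..<h} y)\<^sup>2)) * indicator {0<..<h} y" for n y
    by (auto simp: F_def indicator_def)
  have [measurable]: "F n \<in> borel_measurable lborel" for n
    unfolding F_eq by measurable
  have lim: "(\<lambda>n. \<integral>\<^sup>+y. F n y \<partial>lborel) \<longlonglongrightarrow> 0"
    using lim by (simp add: F_def)
  then obtain k where k: "strict_mono k" and AE: "AE y in lborel. (\<lambda>n. F (k n) y) \<longlonglongrightarrow> 0"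
    using nn_integral_tendsto_0_AE_subseq[of F lborel] by auto
  \<comment> \<open>The good points: almost all of the segment. There the weight is positive, so
    vanishing of the weighted error forces \<open>\<phi> (k n) y\<close> to converge to
    \<open>v y\<close>.\<close>
  define S where "S = {y \<in> {0<..<h}. (\<lambda>n. F (k n) y) \<longlonglongrightarrow> 0}"
  have ptw: "(\<lambda>n. \<phi> (k n) y) \<longlonglongrightarrow> v y" if "y \<in> S" for y
  proof -
    have "(\<lambda>n. ennreal (y powr a * ((\<phi>' (k n) y - w y)\<^sup>2 + (\<phi> (k n) y - v y)\<^sup>2))) \<longlonglongrightarrow> ennreal 0"
      using that by (auto simp: S_def F_def)
    then have *: "(\<lambda>n. y powr a * ((\<phi>' (k n) y - w y)\<^sup>2 + (\<phi> (k n) y - v y)\<^sup>2)) \<longlonglongrightarrow> 0"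
      by (subst (asm) tendsto_ennreal_iff) auto
    have "y > 0" using that by (simp add: S_def)
    have "(\<lambda>n. (1 / y powr a) * (y powr a * ((\<phi>' (k n) y - w y)\<^sup>2 + (\<phi> (k n) y - v y)\<^sup>2))) \<longlonglongrightarrow> 1 / y powr a * 0"
      by (intro tendsto_intros *)
    then have "(\<lambda>n. ((\<phi>' (k n) y - w y)\<^sup>2 + (\<phi> (k n) y - v y)\<^sup>2)) \<longlonglongrightarrow> 0"
      using \<open>y > 0\<close> by simp
    then have "(\<lambda>n. (\<phi> (k n) y - v y)\<^sup>2) \<longlonglongrightarrow> 0"
      by (rule tendsto_sandwich[rotated -1]) auto
    then have "(\<lambda>n. \<phi> (k n) y - v y) \<longlonglongrightarrow> 0"
      by simp
    then show ?thesis by (simp add: LIM_zero_iff)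
  qed
  have incr: "ennreal ((v t - v s)\<^sup>2) \<le> ennreal W * (2 * E)" if "s \<in> S" "t \<in> S" "s \<le> t" for s t
  proof (rule LIMSEQ_le)
    show "(\<lambda>n. ennreal ((\<phi> (k n) t - \<phi> (k n) s)\<^sup>2)) \<longlonglongrightarrow> ennreal ((v t - v s)\<^sup>2)"
      by (intro tendsto_intros tendsto_ennrealI ptw that)
    have "(\<lambda>n. ennreal W * (2 * E + 2 * (\<integral>\<^sup>+y. F (k n) y \<partial>lborel))) \<longlonglongrightarrow> ennreal W * (2 * E + 2 * 0)"
      by (intro tendsto_add ennreal_tendsto_cmult tendsto_const LIMSEQ_subseq_LIMSEQ[OF lim k, unfolded o_def]) auto
    then show "(\<lambda>n. ennreal W * (2 * E + 2 * (\<integral>\<^sup>+y. F (k n) y \<partial>lborel))) \<longlonglongrightarrow> ennreal W * (2 * E)"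
      by simp
    have "ennreal ((\<phi> n t - \<phi> n s)\<^sup>2) \<le> ennreal W * (2 * E + 2 * (\<integral>\<^sup>+y. F n y \<partial>lborel))" for n
    proof -
      have "ennreal ((\<phi> n t - \<phi> n s)\<^sup>2) \<le> ennreal W * (\<integral>\<^sup>+y \<in> {0<..<h}. ennreal (y powr a * (\<phi>' n y)\<^sup>2) \<partial>lborel)"
        unfolding W_def using that by (intro weighted_increment_bound assms d c) (auto simp: S_def)
      also have "(\<integral>\<^sup>+y \<in> {0<..<h}. ennreal (y powr a * (\<phi>' n y)\<^sup>2) \<partial>lborel)
          \<le> (\<integral>\<^sup>+y. 2 * (ennreal (y powr a * (w y)\<^sup>2) * indicator {0<..<h} y) + 2 * F n y \<partial>lborel)"
      proof (rule nn_integral_mono)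
        fix y :: real
        \<comment> \<open>Right side minus left side is the square of
          \<open>2 * w y - \<phi>' n y\<close> plus twice the square of
          \<open>\<phi> n y - v y\<close>.\<close>
        have "(\<phi>' n y)\<^sup>2 \<le> 2 * (w y)\<^sup>2 + 2 * ((\<phi>' n y - w y)\<^sup>2 + (\<phi> n y - v y)\<^sup>2)"
          using zero_le_power2[of "2 * w y - \<phi>' n y"] zero_le_power2[of "\<phi> n y - v y"]
          by (simp add: power2_eq_square algebra_simps)
        then have "y powr a * (\<phi>' n y)\<^sup>2 \<le> y powr a * (2 * (w y)\<^sup>2 + 2 * ((\<phi>' n y - w y)\<^sup>2 + (\<phi> n y - v y)\<^sup>2))"
          by (intro mult_left_mono) auto
        also have "ennreal \<dots> = 2 * ennreal (y powr a * (w y)\<^sup>2) +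
            2 * ennreal (y powr a * ((\<phi>' n y - w y)\<^sup>2 + (\<phi> n y - v y)\<^sup>2))"
        proof -
          have "ennreal (2 * \<alpha> + 2 * \<beta>) = 2 * ennreal \<alpha> + 2 * ennreal \<beta>" if "0 \<le> \<alpha>" "0 \<le> \<beta>" for \<alpha> \<beta>
            using that by (simp add: ennreal_mult')
          from this[of "y powr a * (w y)\<^sup>2" "y powr a * ((\<phi>' n y - w y)\<^sup>2 + (\<phi> n y - v y)\<^sup>2)"]
          show ?thesis by (simp add: algebra_simps)
        qed
        finally have "ennreal (y powr a * (\<phi>' n y)\<^sup>2) \<le> 2 * ennreal (y powr a * (w y)\<^sup>2) +
            2 * ennreal (y powr a * ((\<phi>' n y - w y)\<^sup>2 + (\<phi> n y - v y)\<^sup>2))"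
          by (simp add: ennreal_leI)
        then show "ennreal (y powr a * (\<phi>' n y)\<^sup>2) * indicator {0<..<h} y \<le>
          2 * (ennreal (y powr a * (w y)\<^sup>2) * indicator {0<..<h} y) + 2 * F n y"
          by (auto simp: F_def indicator_def)
      qed
      also have "\<dots> = 2 * E + 2 * (\<integral>\<^sup>+y. F n y \<partial>lborel)"
        by (subst nn_integral_add) (auto simp: nn_integral_cmult E_def)
      finally show ?thesis by (simp add: mult_left_mono)
    qed
    then show "\<exists>N. \<forall>n\<ge>N. ennreal ((\<phi> (k n) t - \<phi> (k n) s)\<^sup>2) \<le> ennreal W * (2 * E + 2 * (\<integral>\<^sup>+y. F (k n) y \<partial>lborel))"
      by blast
  qed
  \<comment> \<open>A set of full measure meets every nonempty open subinterval; this supplies good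
    points approaching both endpoints.\<close>
  have dense: "\<exists>y \<in> S. \<alpha> < y \<and> y < \<beta>" if "0 \<le> \<alpha>" "\<alpha> < \<beta>" "\<beta> \<le> h" for \<alpha> \<beta>
  proof (rule ccontr)
    assume no: "\<not> ?thesis"
    from AE have "AE y in lborel. y \<notin> {\<alpha><..<\<beta>}"
    proof eventually_elim
      case (elim y)
      show ?case
      proof
        assume "y \<in> {\<alpha><..<\<beta>}"
        with elim that have "y \<in> S" by (simp add: S_def)
        with no \<open>y \<in> {\<alpha><..<\<beta>}\<close> show False by auto
      qed
    qed
    then have "{\<alpha><..<\<beta>} \<in> null_sets lborel"
      by (subst AE_iff_null_sets) auto
    then have "emeasure lborel {\<alpha><..<\<beta>} = 0" by auto
    with that show False by simp
  qed
  \<comment> \<open>Dividing by \<open>n + 2\<close> keeps the left points below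
    \<open>h / 2\<close> and the right points above it, so that \<open>s n \<le> t n\<close> already
    from \<open>n = 0\<close>.\<close>
  have "\<exists>s \<in> S. s < h / Suc (Suc n)" for n
    using dense[of 0 "h / Suc (Suc n)"] \<open>0 < h\<close> by (auto simp: field_simps)
  then obtain s where s: "\<And>n. s n \<in> S" "\<And>n. s n < h / Suc (Suc n)" by metis
  have "\<exists>t \<in> S. h - h / Suc (Suc n) < t" for n
    using dense[of "h - h / Suc (Suc n)" h] \<open>0 < h\<close> by (auto simp: field_simps)
  then obtain t where t: "\<And>n. t n \<in> S" "\<And>n. h - h / Suc (Suc n) < t n" by metis
  have st: "s n \<in> {0..h}" "t n \<in> {0..h}" "s n \<le> t n" for n
  proof -
    have "h / Suc (Suc n) \<le> h / 2"
      using \<open>0 < h\<close> by (intro divide_left_mono) auto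
    then show "s n \<le> t n" using s(2)[of n] t(2)[of n] by linarith
  qed (use s(1)[of n] t(1)[of n] in \<open>auto simp: S_def\<close>)
  have h0: "(\<lambda>n. h / Suc (Suc n)) \<longlonglongrightarrow> 0"
    using LIMSEQ_Suc[OF LIMSEQ_Suc[OF lim_const_over_n[of h]]] by simp
  have s0: "s \<longlonglongrightarrow> 0"
    by (rule tendsto_sandwich[OF _ _ tendsto_const h0]) (use s(2) st in \<open>auto intro!: always_eventually less_imp_le\<close>)
  have th: "t \<longlonglongrightarrow> h"
  proof (rule tendsto_sandwich[of "\<lambda>n. h - h / Suc (Suc n)" _ _ "\<lambda>_. h"])
    show "(\<lambda>n. h - h / Suc (Suc n)) \<longlonglongrightarrow> h"
      using tendsto_diff[OF tendsto_const h0, of h] by simp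
  qed (use t(2) st in \<open>auto intro!: always_eventually less_imp_le\<close>)
  have "(\<lambda>n. v (s n)) \<longlonglongrightarrow> v 0" "(\<lambda>n. v (t n)) \<longlonglongrightarrow> v h"
    using \<open>0 < h\<close> st
    by (auto intro!: continuous_on_tendsto_compose[OF v] s0 th always_eventually)
  then have "(\<lambda>n. ennreal ((v (t n) - v (s n))\<^sup>2)) \<longlonglongrightarrow> ennreal ((v h - v 0)\<^sup>2)"
    by (intro tendsto_intros tendsto_ennrealI)
  then have *: "ennreal ((v h - v 0)\<^sup>2) \<le> ennreal W * (2 * E)"
    by (rule LIMSEQ_le_const2) (use incr s t st in auto)
  have "(v 0)\<^sup>2 \<le> 2 * (v h)\<^sup>2 + 2 * (v h - v 0)\<^sup>2"
    using zero_le_power2[of "2 * v h - v 0"] by (simp add: power2_eq_square algebra_simps)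
  then have "ennreal ((v 0)\<^sup>2) \<le> ennreal (2 * (v h)\<^sup>2 + 2 * (v h - v 0)\<^sup>2)"
    by (rule ennreal_leI)
  also have "\<dots> = ennreal (2 * (v h)\<^sup>2) + 2 * ennreal ((v h - v 0)\<^sup>2)"
    by (subst ennreal_plus) (auto simp: ennreal_mult')
  also have "\<dots> \<le> ennreal (2 * (v h)\<^sup>2) + 2 * (ennreal W * (2 * E))"
    by (intro add_left_mono mult_left_mono *) auto
  also have "2 * (ennreal W * (2 * E)) = ennreal (4 * W) * E"
    using \<open>W > 0\<close> by (simp add: ennreal_mult' algebra_simps)
  finally show ?thesis by (simp add: W_def E_def)
qed

section \<open>Gradients of smooth functions\<close>

lemma grad_eqI: "GDERIV f x :> D \<Longrightarrow> grad f x = D"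
  unfolding grad_def
proof (rule the_equality)
  fix D' assume "GDERIV f x :> D" "GDERIV f x :> D'"
  then have "(\<lambda>h. inner h D') = (\<lambda>h. inner h D)"
    unfolding gderiv_def by (rule has_derivative_unique[rotated])
  then show "D' = D"
    by (metis inner_commute vector_eq_ldot)
qed

text \<open>Riesz representation in coordinates: the derivative \<open>L\<close> is the inner
  product with the vector whose coordinates are the values \<open>L b\<close> on the basis. This
  gives the definite description in \<open>grad\<close> a witness.\<close>

lemma GDERIV_grad:
  fixes f :: "'a::euclidean_space \<Rightarrow> real"
  assumes "f differentiable (at x)"
  shows "GDERIV f x :> grad f x"
proof -
  define L where "L = frechet_derivative f (at x)"
  have L: "(f has_derivative L) (at x)"
    using assms by (simp add: L_def frechet_derivative_works)
  then have lin: "linear L" by (rule has_derivative_linear)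
  have "L h = inner h (\<Sum>b\<in>Basis. L b *\<^sub>R b)" for h
  proof -
    have "L h = L (\<Sum>b\<in>Basis. inner h b *\<^sub>R b)" by (simp add: euclidean_representation)
    also have "\<dots> = (\<Sum>b\<in>Basis. inner h b * L b)"
      using lin by (simp add: linear_sum linear_scale)
    finally show ?thesis by (simp add: inner_sum_right mult.commute)
  qed
  then have "L = (\<lambda>h. inner h (\<Sum>b\<in>Basis. L b *\<^sub>R b))"
    by (rule ext)
  with L have "GDERIV f x :> (\<Sum>b\<in>Basis. L b *\<^sub>R b)"
    unfolding gderiv_def by (rule has_derivative_subst)
  then show ?thesis by (simp add: grad_eqI)
qed

lemma smooth_differentiable: "smooth f \<Longrightarrow> f differentiable (at x)"
  unfolding smooth_def by (drule spec[of _ "Suc 0"]) simp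

text \<open>The coordinates of the gradient are directional derivatives along basis vectors, and
  \<open>Ck\<close> of order 1 makes these continuous.\<close>

lemma continuous_on_grad:
  fixes f :: "'a::euclidean_space \<Rightarrow> real"
  assumes "smooth f"
  shows "continuous_on UNIV (grad f)"
proof -
  have Df: "frechet_derivative f (at x) v = inner v (grad f x)" for x v
    using GDERIV_grad[OF smooth_differentiable[OF assms]] unfolding gderiv_def
    by (metis frechet_derivative_at)
  have "continuous_on UNIV (\<lambda>x. frechet_derivative f (at x) v)" for v
    using assms unfolding smooth_def by (auto dest: spec[of _ "Suc 0"])
  then have "continuous_on UNIV (\<lambda>x. \<Sum>b\<in>Basis. inner b (grad f x) *\<^sub>R b)"
    unfolding Df by (intro continuous_on_sum continuous_on_scaleR continuous_on_const) auto
  moreover have "(\<Sum>b\<in>Basis. inner b (grad f x) *\<^sub>R b) = grad f x" for x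
    using euclidean_representation[of "grad f x"] by (simp add: inner_commute)
  ultimately show ?thesis by simp
qed

lemma smooth_continuous_on: "smooth f \<Longrightarrow> continuous_on S f"
  by (meson continuous_at_imp_continuous_on differentiable_imp_continuous_within smooth_differentiable)

section \<open>Geometry of half-balls and integration along vertical lines\<close>

lemma open_half_ball: "open (half_ball r)"
  unfolding half_ball_def by (intro open_Collect_conj open_Collect_less continuous_intros)

lemma sets_half_ball [measurable]: "half_ball r \<in> sets borel"
  by (rule borel_open[OF open_half_ball])

lemma half_ball_mono: "r \<le> s \<Longrightarrow> half_ball r \<subseteq> half_ball s"
  by (auto simp: half_ball_def)

lemma mem_half_ball_Pair:
  fixes x :: "real ^ 'n"
  assumes "norm x < r"
  shows "(x, y) \<in> half_ball r \<longleftrightarrow> 0 < y \<and> y < sqrt (r\<^sup>2 - (norm x)\<^sup>2)"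
proof -
  have "r > 0" using assms norm_ge_zero[of x] by linarith
  have "sqrt ((norm x)\<^sup>2 + y\<^sup>2) < r \<longleftrightarrow> y < sqrt (r\<^sup>2 - (norm x)\<^sup>2)" if "0 < y"
  proof -
    have "sqrt ((norm x)\<^sup>2 + y\<^sup>2) < r \<longleftrightarrow> (norm x)\<^sup>2 + y\<^sup>2 < r\<^sup>2"
      using \<open>r > 0\<close> by (metis abs_of_pos real_sqrt_abs real_sqrt_less_iff)
    also have "\<dots> \<longleftrightarrow> y\<^sup>2 < r\<^sup>2 - (norm x)\<^sup>2" by auto
    also have "\<dots> \<longleftrightarrow> y < sqrt (r\<^sup>2 - (norm x)\<^sup>2)"
      using that by (metis abs_of_pos real_sqrt_abs real_sqrt_less_iff)
    finally show ?thesis .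
  qed
  then show ?thesis by (auto simp: half_ball_def norm_Pair)
qed

lemma half_sphere_height_bounds:
  fixes x :: "'a::real_normed_vector"
  assumes "norm x < r"
  shows "0 < sqrt (r\<^sup>2 - (norm x)\<^sup>2)" "sqrt (r\<^sup>2 - (norm x)\<^sup>2) \<le> r"
proof -
  show "0 < sqrt (r\<^sup>2 - (norm x)\<^sup>2)" using assms by (simp add: power_strict_mono)
  have "sqrt (r\<^sup>2 - (norm x)\<^sup>2) \<le> sqrt (r\<^sup>2)" by (subst real_sqrt_le_iff) simp
  also have "\<dots> = r" using assms norm_ge_zero[of x] by (simp del: norm_ge_zero)
  finally show "sqrt (r\<^sup>2 - (norm x)\<^sup>2) \<le> r" .
qed

lemma fst_half_ball: "(x, y) \<in> half_ball r \<Longrightarrow> norm x < r"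
  using norm_fst_le[of x y] by (auto simp: half_ball_def)

text \<open>Tonelli's theorem, with the half-ball seen as the region between the flat ball and the
  graph of the half-sphere. Measurability is asked only of the product with the indicator, since
  Sobolev functions are controlled only inside the half-ball. The second claim allows slice
  integrals to be used as functions of \<open>x\<close>.\<close>

lemma nn_integral_half_ball_iterated:
  fixes F :: "(real ^ 'n) \<times> real \<Rightarrow> ennreal"
  assumes "(\<lambda>z. F z * indicator (half_ball r) z) \<in> borel_measurable lborel"
  shows "(\<integral>\<^sup>+z \<in> half_ball r. F z \<partial>lborel) =
    (\<integral>\<^sup>+x \<in> ball 0 r. (\<integral>\<^sup>+y \<in> {0<..<sqrt (r\<^sup>2 - (norm x)\<^sup>2)}. F (x, y) \<partial>lborel) \<partial>lborel)"
    (is "?l = ?r")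
    and "(\<lambda>x. (\<integral>\<^sup>+y \<in> {0<..<sqrt (r\<^sup>2 - (norm x)\<^sup>2)}. F (x, y) \<partial>lborel) * indicator (ball 0 r) x)
      \<in> borel_measurable lborel"
proof -
  let ?G = "\<lambda>z. F z * indicator (half_ball r) z"
  have G: "?G \<in> borel_measurable (lborel \<Otimes>\<^sub>M lborel)"
    using assms by (simp add: lborel_prod)
  have eq: "(\<integral>\<^sup>+y. ?G (x, y) \<partial>lborel) =
      (\<integral>\<^sup>+y \<in> {0<..<sqrt (r\<^sup>2 - (norm x)\<^sup>2)}. F (x, y) \<partial>lborel) * indicator (ball 0 r) x" for x
  proof (cases "norm x < r")
    case True
    then show ?thesis
      by (auto simp: mem_half_ball_Pair indicator_def intro!: nn_integral_cong)
  next
    case False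
    then have "(x, y) \<notin> half_ball r" for y using fst_half_ball by blast
    then show ?thesis using False by simp
  qed
  show "?l = ?r"
    using lborel.nn_integral_fst[OF G] by (simp add: lborel_prod eq)
  show "(\<lambda>x. (\<integral>\<^sup>+y \<in> {0<..<sqrt (r\<^sup>2 - (norm x)\<^sup>2)}. F (x, y) \<partial>lborel) * indicator (ball 0 r) x)
      \<in> borel_measurable lborel"
    using lborel.borel_measurable_nn_integral_fst[OF G] by (simp add: eq)
qed

lemma set_borel_measurable_half_ball:
  fixes f :: "(real ^ 'n) \<times> real \<Rightarrow> 'b::{banach, second_countable_topology}"
  assumes "set_borel_measurable lborel (half_ball 1) f" "r \<le> 1"
  shows "set_borel_measurable lborel (half_ball r) f"
  by (rule set_borel_measurable_subset[OF assms(1)])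
    (use assms(2) in \<open>auto simp: half_ball_mono open_half_ball\<close>)

section \<open>Weighted energy and the trace inequality\<close>

text \<open>A single approximating function at distance below 1 suffices: its gradient is bounded on
  the closed unit ball, the weight \<open>y powr a\<close> is integrable because
  \<open>-1 < a\<close>, and the remaining error has finite norm.\<close>

lemma weighted_energy_finite:
  fixes u :: "(real ^ 'n) \<times> real \<Rightarrow> real"
  assumes "-1 < a" "has_H1a_gradient a 1 u V"
  shows "(\<integral>\<^sup>+z \<in> half_ball 1. ennreal (snd z powr a * (norm (V z))\<^sup>2) \<partial>lborel) < \<infinity>"
proof -
  obtain f where f: "H1a_limit a 1 f u V"
    using assms(2) by (auto simp: has_H1a_gradient_def)
  then have "\<forall>\<^sub>F n in sequentially. H1a_sqnorm a 1 (\<lambda>z. f n z - u z) (\<lambda>z. grad (f n) z - V z) < 1"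
    by (intro order_tendstoD(2)[of _ 0]) (auto simp: H1a_limit_def)
  then obtain n where n: "H1a_sqnorm a 1 (\<lambda>z. f n z - u z) (\<lambda>z. grad (f n) z - V z) < 1"
    by (auto simp: eventually_sequentially)
  have sm: "smooth (f n)" and [measurable]: "(\<lambda>z. indicator (half_ball 1) z *\<^sub>R u z) \<in> borel_measurable lborel"
      "(\<lambda>z. indicator (half_ball 1) z *\<^sub>R V z) \<in> borel_measurable lborel"
    using f by (auto simp: H1a_limit_def set_borel_measurable_def)
  note [measurable] = borel_measurable_continuous_onI[OF smooth_continuous_on[OF sm]]
    borel_measurable_continuous_onI[OF continuous_on_grad[OF sm]]
  have "compact (grad (f n) ` cball 0 1)"
    by (rule compact_continuous_image[OF continuous_on_subset[OF continuous_on_grad[OF sm]]]) auto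
  then have "bounded (grad (f n) ` cball 0 1)"
    by (rule compact_imp_bounded)
  then obtain B where "\<forall>v \<in> grad (f n) ` cball 0 1. norm v \<le> B"
    unfolding bounded_iff ..
  then have B: "norm (grad (f n) z) \<le> B" if "norm z \<le> 1" for z
    using that by (simp del: split_paired_All)
  define Y where "Y z = ennreal (snd z powr a) * indicator (half_ball 1) z" for z :: "(real ^ 'n) \<times> real"
  define X where "X z = ennreal (snd z powr a * ((norm (grad (f n) z - V z))\<^sup>2 + (f n z - u z)\<^sup>2)) * indicator (half_ball 1) z" for z
  have X_eq: "X z = ennreal (snd z powr a * ((norm (grad (f n) z - indicator (half_ball 1) z *\<^sub>R V z))\<^sup>2 +
      (f n z - indicator (half_ball 1) z *\<^sub>R u z)\<^sup>2)) * indicator (half_ball 1) z" for z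
    by (auto simp: X_def indicator_def)
  have [measurable]: "snd \<in> borel_measurable (borel :: ((real ^ 'n) \<times> real) measure)"
    by (intro borel_measurable_continuous_onI continuous_intros)
  have [measurable]: "Y \<in> borel_measurable lborel" "X \<in> borel_measurable lborel"
    unfolding Y_def X_eq by measurable
  have mY: "(\<lambda>z. ennreal (snd z powr a) * indicator (half_ball 1) z) \<in> borel_measurable (lborel :: ((real ^ 'n) \<times> real) measure)"
    by measurable
  have "(\<integral>\<^sup>+z. Y z \<partial>lborel) = (\<integral>\<^sup>+z \<in> half_ball 1. ennreal (snd z powr a) \<partial>(lborel :: ((real^'n) \<times> real) measure))"
    by (simp add: Y_def)
  also have "\<dots> = (\<integral>\<^sup>+x \<in> ball 0 1. (\<integral>\<^sup>+y \<in> {0<..<sqrt (1 - (norm x)\<^sup>2)}. ennreal (y powr a) \<partial>lborel) \<partial>(lborel :: (real^'n) measure))"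
    using nn_integral_half_ball_iterated(1)[OF mY] by simp
  \<comment> \<open>Every vertical segment has length at most 1, and the weight integrates to
    \<open>1 / (a + 1)\<close> over the unit interval.\<close>
  also have "\<dots> \<le> (\<integral>\<^sup>+x \<in> ball 0 1. ennreal (1 / (a + 1)) \<partial>(lborel :: (real^'n) measure))"
  proof (intro nn_integral_mono mult_right_mono)
    fix x :: "real ^ 'n"
    have "(\<integral>\<^sup>+y \<in> {0<..<sqrt (1 - (norm x)\<^sup>2)}. ennreal (y powr a) \<partial>lborel) \<le>
        (\<integral>\<^sup>+y \<in> {0<..<1}. ennreal (y powr a) \<partial>lborel)"
    proof (intro nn_integral_mono mult_left_mono)
      have *: "sqrt (1 - (norm x)\<^sup>2) \<le> 1" by simp
      show "indicator {0<..<sqrt (1 - (norm x)\<^sup>2)} y \<le> (indicator {0<..<1} y :: ennreal)" for y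
        by (auto simp: indicator_def dest: less_le_trans[OF _ *])
    qed auto
    also have "\<dots> = ennreal (1 / (a + 1))"
      using nn_integral_powr_Ioo[of a 1] assms(1) by simp
    finally show "(\<integral>\<^sup>+y \<in> {0<..<sqrt (1 - (norm x)\<^sup>2)}. ennreal (y powr a) \<partial>lborel) \<le> ennreal (1 / (a + 1))" .
  qed auto
  also have "\<dots> < \<infinity>"
    using emeasure_lborel_ball_finite[of "0 :: real ^ 'n" 1]
    by (simp add: nn_integral_cmult_indicator ennreal_mult_less_top)
  finally have Y_fin: "(\<integral>\<^sup>+z. Y z \<partial>lborel) < \<infinity>" .
  have "(\<integral>\<^sup>+z \<in> half_ball 1. ennreal (snd z powr a * (norm (V z))\<^sup>2) \<partial>lborel) \<le>
      (\<integral>\<^sup>+z. ennreal (2 * B\<^sup>2) * Y z + 2 * X z \<partial>lborel)"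
  proof (rule nn_integral_mono)
    fix z :: "(real ^ 'n) \<times> real"
    show "ennreal (snd z powr a * (norm (V z))\<^sup>2) * indicator (half_ball 1) z \<le> ennreal (2 * B\<^sup>2) * Y z + 2 * X z"
    proof (cases "z \<in> half_ball 1")
      case True
      let ?g = "grad (f n) z"
      have "(norm (V z))\<^sup>2 \<le> (norm ?g + norm (?g - V z))\<^sup>2"
        by (intro power_mono) (metis add.commute norm_minus_commute norm_triangle_sub, simp)
      also have "\<dots> \<le> 2 * (norm ?g)\<^sup>2 + 2 * (norm (?g - V z))\<^sup>2"
        using zero_le_power2[of "norm ?g - norm (?g - V z)"] by (simp add: power2_eq_square algebra_simps)
      also have "\<dots> \<le> 2 * B\<^sup>2 + 2 * ((norm (?g - V z))\<^sup>2 + (f n z - u z)\<^sup>2)"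
      proof -
        have "(norm ?g)\<^sup>2 \<le> B\<^sup>2"
          using B[of z] True by (intro power_mono) (auto simp: half_ball_def)
        then show ?thesis by (intro add_mono mult_left_mono) auto
      qed
      finally have "snd z powr a * (norm (V z))\<^sup>2 \<le> snd z powr a * (2 * B\<^sup>2 + 2 * ((norm (?g - V z))\<^sup>2 + (f n z - u z)\<^sup>2))"
        by (intro mult_left_mono) auto
      also have "\<dots> = 2 * B\<^sup>2 * snd z powr a + 2 * (snd z powr a * ((norm (?g - V z))\<^sup>2 + (f n z - u z)\<^sup>2))"
        by (simp add: algebra_simps)
      also have "ennreal \<dots> = ennreal (2 * B\<^sup>2) * ennreal (snd z powr a) + 2 * ennreal (snd z powr a * ((norm (?g - V z))\<^sup>2 + (f n z - u z)\<^sup>2))"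
        by (subst ennreal_plus) (auto simp: ennreal_mult' simp flip: ennreal_mult)
      finally show ?thesis using True by (simp add: X_def Y_def ennreal_leI)
    qed simp
  qed
  also have "\<dots> = ennreal (2 * B\<^sup>2) * (\<integral>\<^sup>+z. Y z \<partial>lborel) + 2 * (\<integral>\<^sup>+z. X z \<partial>lborel)"
    by (simp add: nn_integral_add nn_integral_cmult)
  also have "\<dots> < \<infinity>"
    using Y_fin n by (auto simp: X_def H1a_sqnorm_def ennreal_mult_less_top intro: less_trans)
  finally show ?thesis .
qed

text \<open>By Tonelli, convergence in the Sobolev norm is convergence to 0 of the integral of the
  slice errors. A subsequence of these errors tends to 0 on almost every vertical line, the segment
  estimate applies on each such line, and integration in \<open>x\<close> gives the claim.\<close>

lemma trace_inequality:
  fixes u :: "(real ^ 'n) \<times> real \<Rightarrow> real"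
  assumes "a < 1" "0 < r" "r < 1"
    and grad: "has_H1a_gradient a 1 u V"
    and cont: "continuous_on (half_ball 1 \<union> ball 0 1 \<times> {0}) u"
  shows "(\<integral>\<^sup>+x \<in> ball 0 r. ennreal ((u (x, 0))\<^sup>2) \<partial>lborel) \<le>
    2 * (\<integral>\<^sup>+x \<in> ball 0 r. ennreal ((u (x, sqrt (r\<^sup>2 - (norm x)\<^sup>2)))\<^sup>2) \<partial>lborel) +
    ennreal (4 * r powr (1 - a) / (1 - a)) *
      (\<integral>\<^sup>+z \<in> half_ball r. ennreal (snd z powr a * (norm (V z))\<^sup>2) \<partial>lborel)"
proof -
  obtain f where f: "H1a_limit a 1 f u V"
    using grad by (auto simp: has_H1a_gradient_def)
  have sm: "\<And>n. smooth (f n)" and mu: "set_borel_measurable lborel (half_ball 1) u"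
    and mV: "set_borel_measurable lborel (half_ball 1) V"
    and lim: "(\<lambda>n. H1a_sqnorm a 1 (\<lambda>z. f n z - u z) (\<lambda>z. grad (f n) z - V z)) \<longlonglongrightarrow> 0"
    using f by (auto simp: H1a_limit_def)
  have [measurable]: "(\<lambda>z. indicator (half_ball 1) z *\<^sub>R u z) \<in> borel_measurable borel"
      "(\<lambda>z. indicator (half_ball 1) z *\<^sub>R V z) \<in> borel_measurable borel"
      "(\<lambda>z. indicator (half_ball r) z *\<^sub>R V z) \<in> borel_measurable borel"
    using mu mV set_borel_measurable_half_ball[OF mV, of r] \<open>r < 1\<close> by (auto simp: set_borel_measurable_def)
  note [measurable] = borel_measurable_continuous_onI[OF smooth_continuous_on[OF sm]]
    borel_measurable_continuous_onI[OF continuous_on_grad[OF sm]]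
  have [measurable]: "snd \<in> borel_measurable (borel :: ((real ^ 'n) \<times> real) measure)"
    by (intro borel_measurable_continuous_onI continuous_intros)
  define h where "h x = sqrt (r\<^sup>2 - (norm x)\<^sup>2)" for x :: "real ^ 'n"
  have h: "0 < h x" "h x \<le> r" if "norm x < r" for x
    using half_sphere_height_bounds[OF that] by (simp_all add: h_def)
  \<comment> \<open>Only the vertical derivative enters the estimate along a vertical segment; it is
    dominated by the full gradient.\<close>
  define F where "F n z = ennreal (snd z powr a * ((snd (grad (f n) z) - snd (V z))\<^sup>2 + (f n z - u z)\<^sup>2))" for n z
  have F_eq: "F n z * indicator (half_ball 1) z = ennreal (snd z powr a *
      ((snd (grad (f n) z - indicator (half_ball 1) z *\<^sub>R V z))\<^sup>2 +
       (f n z - indicator (half_ball 1) z *\<^sub>R u z)\<^sup>2)) * indicator (half_ball 1) z" for n z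
    by (auto simp: F_def indicator_def)
  have mF: "(\<lambda>z. F n z * indicator (half_ball 1) z) \<in> borel_measurable lborel" for n
    unfolding F_eq by measurable
  \<comment> \<open>The slice error reaches up to the unit half-sphere, where convergence is given.
    It dominates the error on the shorter segment that ends at height \<open>h x\<close>.\<close>
  define A where "A n x = (\<integral>\<^sup>+y \<in> {0<..<sqrt (1\<^sup>2 - (norm x)\<^sup>2)}. F n (x, y) \<partial>lborel) * indicator (ball 0 1) x" for n x
  have [measurable]: "A n \<in> borel_measurable lborel" for n
    using nn_integral_half_ball_iterated(2)[OF mF] by (simp add: A_def[abs_def])
  have A_le: "(\<integral>\<^sup>+x. A n x \<partial>lborel) \<le> H1a_sqnorm a 1 (\<lambda>z. f n z - u z) (\<lambda>z. grad (f n) z - V z)" for n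
  proof -
    have "(\<integral>\<^sup>+x. A n x \<partial>lborel) = (\<integral>\<^sup>+z \<in> half_ball 1. F n z \<partial>lborel)"
      by (subst nn_integral_half_ball_iterated(1)[OF mF]) (simp add: A_def[abs_def])
    also have "\<dots> \<le> H1a_sqnorm a 1 (\<lambda>z. f n z - u z) (\<lambda>z. grad (f n) z - V z)"
      unfolding H1a_sqnorm_def F_def
    proof (intro nn_integral_mono mult_right_mono ennreal_leI mult_left_mono add_right_mono)
      fix z
      have "\<bar>snd (grad (f n) z - V z)\<bar> \<le> norm (grad (f n) z - V z)"
        using norm_snd_le[of "snd (grad (f n) z - V z)" "fst (grad (f n) z - V z)"] by (simp only: prod.collapse real_norm_def)
      then show "(snd (grad (f n) z) - snd (V z))\<^sup>2 \<le> (norm (grad (f n) z - V z))\<^sup>2"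
        by (metis abs_ge_zero power2_abs power_mono snd_diff)
    qed auto
    finally show ?thesis .
  qed
  have "(\<lambda>n. \<integral>\<^sup>+x. A n x \<partial>lborel) \<longlonglongrightarrow> 0"
    by (rule tendsto_sandwich[OF _ _ tendsto_const lim]) (auto simp: A_le)
  then obtain s where AE: "AE x in lborel. (\<lambda>n. A (s n) x) \<longlonglongrightarrow> 0"
    using nn_integral_tendsto_0_AE_subseq[of A lborel] by auto
  define E where "E x = (\<integral>\<^sup>+y \<in> {0<..<h x}. ennreal (y powr a * (norm (V (x, y)))\<^sup>2) \<partial>lborel)" for x
  let ?W = "ennreal (4 * r powr (1 - a) / (1 - a))"
  have key: "ennreal ((u (x, 0))\<^sup>2) \<le> 2 * ennreal ((u (x, h x))\<^sup>2) + ?W * E x"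
    if x: "norm x < r" and A0: "(\<lambda>n. A (s n) x) \<longlonglongrightarrow> 0" for x
  proof -
    \<comment> \<open>The indicator makes \<open>w\<close> measurable on the whole line; on the
      segment it is the vertical component of \<open>V\<close>.\<close>
    define w where "w y = snd (indicator (half_ball 1) (x, y) *\<^sub>R V (x, y))" for y
    \<comment> \<open>Because \<open>r < 1\<close>, the segment including its top endpoint on the
      sphere of radius \<open>r\<close> lies in the open unit half-ball, where \<open>u\<close> is
      continuous.\<close>
    have in1: "(x, y) \<in> half_ball 1" if "0 < y" "y \<le> h x" for y
    proof -
      have "h x < sqrt (1\<^sup>2 - (norm x)\<^sup>2)"
        unfolding h_def using \<open>0 < r\<close> \<open>r < 1\<close> by (subst real_sqrt_less_iff) (simp add: power_strict_mono abs_square_less_1)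
      then show ?thesis using that x \<open>r < 1\<close> by (subst mem_half_ball_Pair) auto
    qed
    have "ennreal ((u (x, 0))\<^sup>2) \<le> ennreal (2 * (u (x, h x))\<^sup>2) + ennreal (4 * h x powr (1 - a) / (1 - a)) *
           (\<integral>\<^sup>+y \<in> {0<..<h x}. ennreal (y powr a * (w y)\<^sup>2) \<partial>lborel)"
    proof (rule weighted_trace_on_segment[where \<phi> = "\<lambda>n y. f (s n) (x, y)" and \<phi>' = "\<lambda>n y. snd (grad (f (s n)) (x, y))"])
      show "((\<lambda>y. f (s n) (x, y)) has_real_derivative snd (grad (f (s n)) (x, y))) (at y)" for n y
      proof -
        have "(f (s n) has_derivative (\<lambda>z. inner z (grad (f (s n)) (x, y)))) (at (x, y))"
          using GDERIV_grad[OF smooth_differentiable[OF sm]] by (simp add: gderiv_def)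
        then have "((\<lambda>y. f (s n) (x, y)) has_derivative (\<lambda>t. inner (0, t) (grad (f (s n)) (x, y)))) (at y)"
          by (rule has_derivative_compose[rotated]) (auto intro!: derivative_eq_intros)
        moreover have "(\<lambda>t. inner (0, t) (grad (f (s n)) (x, y))) = (*) (snd (grad (f (s n)) (x, y)))"
          by (auto simp: inner_prod_def)
        ultimately show ?thesis by (simp add: has_field_derivative_def)
      qed
      show "continuous_on UNIV (\<lambda>y. snd (grad (f (s n)) (x, y)))" for n
        by (rule continuous_on_snd[OF continuous_on_compose2[OF continuous_on_grad[OF sm]]])
          (auto intro!: continuous_intros)
      show "continuous_on {0..h x} (\<lambda>y. u (x, y))"
      proof (rule continuous_on_compose2[OF cont])
        show "Pair x ` {0..h x} \<subseteq> half_ball 1 \<union> ball 0 1 \<times> {0}"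
        proof (rule image_subsetI)
          fix y assume "y \<in> {0..h x}"
          then show "(x, y) \<in> half_ball 1 \<union> ball 0 1 \<times> {0}"
            using in1[of y] x \<open>r < 1\<close> by (cases "y = 0") auto
        qed
      qed (intro continuous_intros)
      show "w \<in> borel_measurable borel"
        unfolding w_def
        by (rule measurable_compose[OF _ borel_measurable_continuous_onI[of snd]],
            rule measurable_compose[of "Pair x" borel borel])
          (auto intro!: borel_measurable_continuous_onI continuous_intros)
      have le: "(\<integral>\<^sup>+y \<in> {0<..<h x}. ennreal (y powr a * ((snd (grad (f (s n)) (x, y)) - w y)\<^sup>2 + (f (s n) (x, y) - u (x, y))\<^sup>2)) \<partial>lborel)
         \<le> A (s n) x" for n
      proof -
        have "A (s n) x = (\<integral>\<^sup>+y \<in> {0<..<sqrt (1\<^sup>2 - (norm x)\<^sup>2)}. F (s n) (x, y) \<partial>lborel)"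
          using x \<open>r < 1\<close> by (simp add: A_def)
        also have "\<dots> \<ge> (\<integral>\<^sup>+y \<in> {0<..<h x}. ennreal (y powr a * ((snd (grad (f (s n)) (x, y)) - w y)\<^sup>2 + (f (s n) (x, y) - u (x, y))\<^sup>2)) \<partial>lborel)"
        proof (rule nn_integral_mono)
          fix y
          show "ennreal (y powr a * ((snd (grad (f (s n)) (x, y)) - w y)\<^sup>2 + (f (s n) (x, y) - u (x, y))\<^sup>2)) * indicator {0<..<h x} y
            \<le> F (s n) (x, y) * indicator {0<..<sqrt (1\<^sup>2 - (norm x)\<^sup>2)} y"
            using in1[of y] mem_half_ball_Pair[of x 1 y] x \<open>r < 1\<close> by (auto simp: indicator_def F_def w_def)
        qed
        finally show ?thesis .
      qed
      show "(\<lambda>n. \<integral>\<^sup>+y \<in> {0<..<h x}. ennreal (y powr a * ((snd (grad (f (s n)) (x, y)) - w y)\<^sup>2 + (f (s n) (x, y) - u (x, y))\<^sup>2)) \<partial>lborel) \<longlonglongrightarrow> 0"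
        by (rule tendsto_sandwich[OF _ _ tendsto_const A0]) (auto simp: le)
    qed (use h[OF x] assms in auto)
    also have "\<dots> \<le> 2 * ennreal ((u (x, h x))\<^sup>2) + ?W * E x"
    proof (intro add_mono mult_mono)
      \<comment> \<open>The constant becomes independent of \<open>x\<close>, as
        \<open>h x \<le> r\<close> and the exponent \<open>1 - a\<close> is positive.\<close>
      show "ennreal (4 * h x powr (1 - a) / (1 - a)) \<le> ?W"
        using h[OF x] \<open>a < 1\<close> by (intro ennreal_leI divide_right_mono mult_left_mono powr_mono2) auto
      show "(\<integral>\<^sup>+y \<in> {0<..<h x}. ennreal (y powr a * (w y)\<^sup>2) \<partial>lborel) \<le> E x"
        unfolding E_def
      proof (intro nn_integral_mono mult_right_mono ennreal_leI mult_left_mono)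
        fix y
        have "\<bar>w y\<bar> \<le> norm (V (x, y))"
          using norm_snd_le[of "snd (V (x, y))" "fst (V (x, y))"] by (simp add: w_def indicator_def)
        then show "(w y)\<^sup>2 \<le> (norm (V (x, y)))\<^sup>2"
          by (metis abs_ge_zero power2_abs power_mono)
      qed auto
    qed (auto simp: ennreal_mult')
    finally show ?thesis .
  qed
  have mE: "(\<lambda>z. ennreal (snd z powr a * (norm (V z))\<^sup>2) * indicator (half_ball r) z) \<in> borel_measurable lborel"
  proof -
    have "(\<lambda>z. ennreal (snd z powr a * (norm (V z))\<^sup>2) * indicator (half_ball r) z) =
      (\<lambda>z. ennreal (snd z powr a * (norm (indicator (half_ball r) z *\<^sub>R V z))\<^sup>2))"
      by (auto simp: indicator_def)
    then show ?thesis by (simp del: norm_scaleR)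
  qed
  note E = nn_integral_half_ball_iterated[OF mE, unfolded snd_conv, folded h_def, folded E_def]
  have [measurable]: "(\<lambda>x. E x * indicator (ball 0 r) x) \<in> borel_measurable lborel"
    using E(2) by simp
  have "continuous_on (ball 0 r) (\<lambda>x. u (x, h x))"
  proof (rule continuous_on_compose2[OF cont])
    have "(x, h x) \<in> half_ball 1" if "norm x < r" for x
      using that h[OF that] \<open>0 < r\<close> \<open>r < 1\<close> by (auto simp: half_ball_def norm_Pair h_def)
    then show "(\<lambda>x. (x, h x)) ` ball 0 r \<subseteq> half_ball 1 \<union> ball 0 1 \<times> {0}"
      by auto
  qed (auto simp: h_def intro!: continuous_intros)
  then have "continuous_on (ball 0 r) (\<lambda>x. (u (x, h x))\<^sup>2)"
    by (intro continuous_intros)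
  then have "(\<lambda>x. indicator (ball 0 r) x *\<^sub>R (u (x, h x))\<^sup>2) \<in> borel_measurable borel"
    by (intro borel_measurable_continuous_on_indicator) auto
  then have "(\<lambda>x. ennreal (indicator (ball 0 r) x *\<^sub>R (u (x, h x))\<^sup>2)) \<in> borel_measurable borel"
    by measurable
  moreover have "ennreal (indicator (ball 0 r) x *\<^sub>R (u (x, h x))\<^sup>2) = ennreal ((u (x, h x))\<^sup>2) * indicator (ball 0 r) x" for x
    by (auto simp: indicator_def)
  ultimately have [measurable]: "(\<lambda>x. ennreal ((u (x, h x))\<^sup>2) * indicator (ball 0 r) x) \<in> borel_measurable borel"
    by (simp only:)
  have "(\<integral>\<^sup>+x \<in> ball 0 r. ennreal ((u (x, 0))\<^sup>2) \<partial>lborel) \<le>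
    (\<integral>\<^sup>+x. 2 * (ennreal ((u (x, h x))\<^sup>2) * indicator (ball 0 r) x) + ?W * (E x * indicator (ball 0 r) x) \<partial>lborel)"
    by (rule nn_integral_mono_AE, use AE in eventually_elim) (use key in \<open>auto simp: indicator_def\<close>)
  also have "\<dots> = 2 * (\<integral>\<^sup>+x \<in> ball 0 r. ennreal ((u (x, h x))\<^sup>2) \<partial>lborel) + ?W * (\<integral>\<^sup>+x \<in> ball 0 r. E x \<partial>lborel)"
    by (simp add: nn_integral_add nn_integral_cmult)
  finally show ?thesis by (simp add: E(1) h_def)
qed

section \<open>Surface integrals over half-spheres and the energy as a Bochner integral\<close>

text \<open>With \<open>h\<close> the height of the sphere above \<open>x\<close>, the gradient of
  the height function is \<open>- x / h\<close>, and
  \<open>h\<^sup>2 + (norm x)\<^sup>2 = r\<^sup>2\<close>.\<close>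

lemma area_element_half_sphere:
  fixes x :: "'a::euclidean_space"
  assumes "norm x < r"
  shows "sqrt (1 + (norm (grad (\<lambda>x. sqrt (r\<^sup>2 - (norm x)\<^sup>2)) x))\<^sup>2) = r / sqrt (r\<^sup>2 - (norm x)\<^sup>2)"
proof -
  define h where "h = sqrt (r\<^sup>2 - (norm x)\<^sup>2)"
  have "0 < r" using assms norm_ge_zero[of x] by linarith
  have pos: "0 < r\<^sup>2 - (norm x)\<^sup>2" using assms by (simp add: power_strict_mono)
  then have "0 < h" by (simp add: h_def)
  have h2: "h\<^sup>2 = r\<^sup>2 - (norm x)\<^sup>2" using pos by (simp add: h_def)
  have "((\<lambda>x. sqrt (r\<^sup>2 - x \<bullet> x)) has_derivative (\<lambda>k. k \<bullet> (- (1 / h) *\<^sub>R x))) (at x)"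
    using pos \<open>0 < h\<close>
    by (auto intro!: derivative_eq_intros simp: h_def power2_norm_eq_inner fun_eq_iff inner_commute field_simps)
  then have "grad (\<lambda>x. sqrt (r\<^sup>2 - (norm x)\<^sup>2)) x = - (1 / h) *\<^sub>R x"
    by (intro grad_eqI) (simp add: gderiv_def power2_norm_eq_inner)
  then have "1 + (norm (grad (\<lambda>x. sqrt (r\<^sup>2 - (norm x)\<^sup>2)) x))\<^sup>2 = (r / h)\<^sup>2"
    using \<open>0 < h\<close> h2 by (simp add: power_divide field_simps)
  then show ?thesis
    using \<open>0 < r\<close> \<open>0 < h\<close> unfolding h_def[symmetric] by simp
qed

lemma half_sphere_integral_eq:
  fixes f :: "(real ^ 'n) \<times> real \<Rightarrow> real"
  shows "half_sphere_integral r f =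
    (LINT x:ball 0 r|lborel. f (x, sqrt (r\<^sup>2 - (norm x)\<^sup>2)) * (r / sqrt (r\<^sup>2 - (norm x)\<^sup>2)))"
  unfolding half_sphere_integral_def graph_integral_def
  by (rule set_lebesgue_integral_cong) (auto simp: area_element_half_sphere)

lemma half_sphere_integral_nonneg:
  fixes f :: "(real ^ 'n) \<times> real \<Rightarrow> real"
  assumes "\<And>z. 0 \<le> f z"
  shows "0 \<le> half_sphere_integral r f"
  unfolding half_sphere_integral_def graph_integral_def set_lebesgue_integral_def
  by (rule integral_nonneg_AE) (auto simp: assms)

text \<open>If the integrand is not integrable, the half-sphere integral is \<open>0\<close> by convention, so a nonzero value
  entails integrability.\<close>

lemma graph_integral_le_half_sphere_integral:
  fixes u :: "(real ^ 'n) \<times> real \<Rightarrow> real"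
  assumes "a < 1" "0 < r" and S: "half_sphere_integral r (\<lambda>z. snd z powr a * (u z)\<^sup>2) \<noteq> 0"
  shows "(\<integral>\<^sup>+x \<in> ball 0 r. ennreal ((u (x, sqrt (r\<^sup>2 - (norm x)\<^sup>2)))\<^sup>2) \<partial>lborel) \<le>
    ennreal (r powr (- a) * half_sphere_integral r (\<lambda>z. snd z powr a * (u z)\<^sup>2))"
proof -
  define h where "h x = sqrt (r\<^sup>2 - (norm x)\<^sup>2)" for x :: "real ^ 'n"
  define I where "I x = indicator (ball 0 r) x * (h x powr a * (u (x, h x))\<^sup>2 * (r / h x))" for x
  have h: "0 < h x" "h x \<le> r" if "norm x < r" for x
    using half_sphere_height_bounds[OF that] by (simp_all add: h_def)
  have I_nonneg: "0 \<le> I x" for x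
    using h[of x] \<open>0 < r\<close> by (auto simp: I_def indicator_def)
  have S_eq: "half_sphere_integral r (\<lambda>z. snd z powr a * (u z)\<^sup>2) = (\<integral>x. I x \<partial>lborel)"
    unfolding half_sphere_integral_eq set_lebesgue_integral_def by (simp add: I_def h_def)
  with S have int: "integrable lborel I"
    using not_integrable_integral_eq by metis
  \<comment> \<open>Weight times area element is \<open>r * h x powr (a - 1)\<close>. The exponent
    is negative and \<open>h x \<le> r\<close>, so this is at least \<open>r powr a\<close>, even
    near the equator where the height tends to 0.\<close>
  have pt: "(u (x, h x))\<^sup>2 \<le> r powr (- a) * I x" if "norm x < r" for x
  proof -
    have "r powr a = r powr (a - 1) * r"
      using \<open>0 < r\<close> by (simp add: powr_diff)
    also have "\<dots> \<le> h x powr (a - 1) * r"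
      using h[OF that] \<open>a < 1\<close> \<open>0 < r\<close> by (intro mult_right_mono powr_mono2') auto
    finally have "r powr a \<le> h x powr (a - 1) * r" .
    then have "r powr (- a) * (r powr a * (u (x, h x))\<^sup>2) \<le> r powr (- a) * (h x powr (a - 1) * r * (u (x, h x))\<^sup>2)"
      by (intro mult_left_mono mult_right_mono) auto
    moreover have "r powr (- a) * r powr a = 1"
      using \<open>0 < r\<close> by (simp flip: powr_add)
    moreover have "h x powr (a - 1) * r * (u (x, h x))\<^sup>2 = I x"
      using h[OF that] that by (simp add: I_def powr_diff)
    ultimately show ?thesis by (simp flip: mult.assoc)
  qed
  have "(\<integral>\<^sup>+x \<in> ball 0 r. ennreal ((u (x, h x))\<^sup>2) \<partial>lborel) \<le> (\<integral>\<^sup>+x. ennreal (r powr (- a) * I x) \<partial>lborel)"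
  proof (rule nn_integral_mono)
    fix x :: "real ^ 'n"
    show "ennreal ((u (x, h x))\<^sup>2) * indicator (ball 0 r) x \<le> ennreal (r powr (- a) * I x)"
      using pt[of x] by (auto simp: indicator_def intro: ennreal_leI)
  qed
  also have "\<dots> = ennreal (\<integral>x. r powr (- a) * I x \<partial>lborel)"
    using int I_nonneg by (intro nn_integral_eq_integral) auto
  finally show ?thesis by (simp add: S_eq h_def)
qed

text \<open>Links the nonnegative integral of the trace inequality to the Bochner integral in
  \<open>D_fun\<close>: finite energy on the unit half-ball gives integrability on every smaller
  one.\<close>

lemma weighted_energy_eq_lebesgue:
  fixes u :: "(real ^ 'n) \<times> real \<Rightarrow> real"
  assumes "-1 < a" "has_H1a_gradient a 1 u V" "r \<le> 1"
  shows "(\<integral>\<^sup>+z \<in> half_ball r. ennreal (snd z powr a * (norm (V z))\<^sup>2) \<partial>lborel) =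
    ennreal (LINT z:half_ball r|lborel. snd z powr a * (norm (V z))\<^sup>2)"
proof -
  define I where "I z = indicator (half_ball r) z * (snd z powr a * (norm (V z))\<^sup>2)" for z
  have "set_borel_measurable lborel (half_ball 1) V"
    using assms(2) by (auto simp: has_H1a_gradient_def H1a_limit_def)
  then have "set_borel_measurable lborel (half_ball r) V"
    using assms(3) by (rule set_borel_measurable_half_ball)
  then have [measurable]: "(\<lambda>z. indicator (half_ball r) z *\<^sub>R V z) \<in> borel_measurable borel"
    by (simp add: set_borel_measurable_def)
  have [measurable]: "snd \<in> borel_measurable (borel :: ((real ^ 'n) \<times> real) measure)"
    by (intro borel_measurable_continuous_onI continuous_intros)
  have "I = (\<lambda>z. snd z powr a * (norm (indicator (half_ball r) z *\<^sub>R V z))\<^sup>2)"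
    by (auto simp: I_def indicator_def)
  then have mI: "I \<in> borel_measurable lborel" by (simp del: norm_scaleR)
  have I: "(\<integral>\<^sup>+z \<in> half_ball r. ennreal (snd z powr a * (norm (V z))\<^sup>2) \<partial>lborel) = (\<integral>\<^sup>+z. ennreal (I z) \<partial>lborel)"
    by (intro nn_integral_cong) (simp add: I_def indicator_def)
  have "(\<integral>\<^sup>+z \<in> half_ball r. ennreal (snd z powr a * (norm (V z))\<^sup>2) \<partial>lborel) \<le>
      (\<integral>\<^sup>+z \<in> half_ball 1. ennreal (snd z powr a * (norm (V z))\<^sup>2) \<partial>lborel)"
    using half_ball_mono[OF assms(3)] by (intro nn_integral_mono) (auto simp: indicator_def)
  also have "\<dots> < \<infinity>" by (rule weighted_energy_finite[OF assms(1,2)])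
  finally have "integrable lborel I"
    using mI unfolding I by (intro integrableI_nonneg) (auto simp: I_def indicator_def)
  then have "(\<integral>\<^sup>+z. ennreal (I z) \<partial>lborel) = ennreal (\<integral>z. I z \<partial>lborel)"
    by (rule nn_integral_eq_integral) (simp add: I_def)
  also have "(\<integral>z. I z \<partial>lborel) = (LINT z:half_ball r|lborel. snd z powr a * (norm (V z))\<^sup>2)"
    by (simp add: set_lebesgue_integral_def I_def)
  finally show ?thesis by (simp only: I)
qed

section \<open>Estimate of the boundary potential\<close>

text \<open>Two powers of \<open>t\<close> are kept and the other \<open>p - 2\<close>, a
  nonnegative exponent, are bounded by those of \<open>M\<close>. This is how
  \<open>2 \<le> p\<close> makes the potential at most quadratic.\<close>

lemma powr_le_quadratic:
  fixes t M p :: real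
  assumes "0 \<le> t" "t \<le> M" "2 \<le> p"
  shows "t powr p \<le> M powr (p - 2) * t\<^sup>2"
proof (cases "t = 0")
  case False
  then have "t powr p = t powr (p - 2) * t\<^sup>2"
    using assms by (simp add: powr_diff)
  then show ?thesis
    using assms by (simp add: mult_right_mono powr_mono2)
qed simp

lemma boundary_potential_le:
  fixes t M p lm lp :: real
  assumes "\<bar>t\<bar> \<le> M" "2 \<le> p" "0 \<le> lm" "0 \<le> lp"
  shows "lm * neg_part t powr p + lp * pos_part t powr p \<le> (lm + lp) * M powr (p - 2) * t\<^sup>2"
proof -
  have q: "neg_part t powr p \<le> M powr (p - 2) * t\<^sup>2" "pos_part t powr p \<le> M powr (p - 2) * t\<^sup>2"
    using powr_le_quadratic[of "\<bar>t\<bar>" M p] assms by (auto simp: neg_part_def pos_part_def max_def)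
  have "lm * neg_part t powr p + lp * pos_part t powr p \<le> lm * (M powr (p - 2) * t\<^sup>2) + lp * (M powr (p - 2) * t\<^sup>2)"
    using assms q by (intro add_mono mult_left_mono)
  then show "lm * neg_part t powr p + lp * pos_part t powr p \<le> (lm + lp) * M powr (p - 2) * t\<^sup>2"
    by (simp add: algebra_simps)
qed

text \<open>The potential is at most a constant times the square of \<open>u\<close> on the flat
  part, which the trace inequality controls by the surface integral and the energy. After
  normalisation both terms carry the extra factor \<open>r powr (1 - a)\<close>. The assumption that
  \<open>H_fun\<close> is nonzero excludes a surface integral that is 0 by default.\<close>

lemma G_fun_bounds:
  fixes u :: "(real ^ 'n) \<times> real \<Rightarrow> real"
  assumes "-1 < a" "a < 1" "2 \<le> p" "0 \<le> lm" "0 \<le> lp" "0 < r" "r < 1"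
    and grad: "has_H1a_gradient a 1 u V"
    and cont: "continuous_on (half_ball 1 \<union> ball 0 1 \<times> {0}) u"
    and M: "\<And>x. norm x < r \<Longrightarrow> \<bar>u (x, 0)\<bar> \<le> M"
    and H: "H_fun a u r \<noteq> 0"
  shows "0 \<le> G_fun a p lm lp u r"
    and "G_fun a p lm lp u r \<le>
      (lm + lp) * M powr (p - 2) * (4 / (1 - a)) * r powr (1 - a) * (H_fun a u r + D_fun a V r)"
proof -
  define N where "N = real CARD('n)"
  define c where "c = (lm + lp) * M powr (p - 2)"
  define S where "S = half_sphere_integral r (\<lambda>z. snd z powr a * (u z)\<^sup>2)"
  define E where "E = (LINT z:half_ball r|lborel. snd z powr a * (norm (V z))\<^sup>2)"
  define T where "T = 2 * (r powr (- a) * S) + 4 * r powr (1 - a) / (1 - a) * E"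
  let ?g = "\<lambda>x. lm * neg_part (u (x, 0)) powr p + lp * pos_part (u (x, 0)) powr p"
  have "0 \<le> c" using assms by (simp add: c_def)
  have "0 \<le> S" unfolding S_def by (rule half_sphere_integral_nonneg) simp
  have "0 \<le> E" unfolding E_def set_lebesgue_integral_def by (rule integral_nonneg_AE) simp
  have "0 \<le> T" using \<open>0 \<le> S\<close> \<open>0 \<le> E\<close> \<open>a < 1\<close> by (simp add: T_def)
  have "S \<noteq> 0" using H by (auto simp: H_fun_def S_def)
  have cont0: "continuous_on (ball 0 r) (\<lambda>x. (u (x, 0))\<^sup>2)"
    using \<open>r < 1\<close>
    by (intro continuous_on_power continuous_on_compose2[OF cont] continuous_intros) auto
  have "(\<integral>\<^sup>+x \<in> ball 0 r. ennreal ((u (x, 0))\<^sup>2) \<partial>lborel) \<le>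
      2 * ennreal (r powr (- a) * S) + ennreal (4 * r powr (1 - a) / (1 - a)) * ennreal E"
    using trace_inequality[OF \<open>a < 1\<close> \<open>0 < r\<close> \<open>r < 1\<close> grad cont]
      graph_integral_le_half_sphere_integral[OF \<open>a < 1\<close> \<open>0 < r\<close> \<open>S \<noteq> 0\<close>[unfolded S_def]]
      weighted_energy_eq_lebesgue[OF \<open>-1 < a\<close> grad, of r] \<open>r < 1\<close>
    unfolding S_def E_def by (auto elim!: order_trans intro!: add_mono mult_left_mono)
  also have "\<dots> = ennreal T"
  proof -
    have "2 * ennreal \<alpha> + ennreal \<beta> * ennreal E = ennreal (2 * \<alpha> + \<beta> * E)" if "0 \<le> \<alpha>" "0 \<le> \<beta>" for \<alpha> \<beta>
      using that \<open>0 \<le> E\<close> by (simp add: ennreal_mult')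
    then show ?thesis
      using \<open>0 \<le> S\<close> \<open>a < 1\<close> unfolding T_def by simp
  qed
  finally have tr: "(\<integral>\<^sup>+x \<in> ball 0 r. ennreal ((u (x, 0))\<^sup>2) \<partial>lborel) \<le> ennreal T" .
  have "(\<integral>\<^sup>+x. ennreal (indicator (ball 0 r) x *\<^sub>R ?g x) \<partial>lborel) \<le>
      (\<integral>\<^sup>+x. ennreal c * ennreal (indicator (ball 0 r) x *\<^sub>R (u (x, 0))\<^sup>2) \<partial>lborel)"
  proof (rule nn_integral_mono)
    fix x :: "real ^ 'n"
    show "ennreal (indicator (ball 0 r) x *\<^sub>R ?g x) \<le> ennreal c * ennreal (indicator (ball 0 r) x *\<^sub>R (u (x, 0))\<^sup>2)"
      using boundary_potential_le[OF M[of x] assms(3-5)] \<open>0 \<le> c\<close>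
      by (auto simp: indicator_def c_def ennreal_leI simp flip: ennreal_mult')
  qed
  also have "\<dots> = ennreal c * (\<integral>\<^sup>+x. ennreal (indicator (ball 0 r) x *\<^sub>R (u (x, 0))\<^sup>2) \<partial>lborel)"
    using borel_measurable_continuous_on_indicator[OF _ cont0]
    by (intro nn_integral_cmult measurable_compose[OF _ measurable_ennreal]) auto
  also have "(\<integral>\<^sup>+x. ennreal (indicator (ball 0 r) x *\<^sub>R (u (x, 0))\<^sup>2) \<partial>lborel) =
      (\<integral>\<^sup>+x \<in> ball 0 r. ennreal ((u (x, 0))\<^sup>2) \<partial>lborel)"
    by (intro nn_integral_cong) (simp add: indicator_def)
  also have "ennreal c * \<dots> \<le> ennreal c * ennreal T"
    by (intro mult_left_mono tr) simp
  also have "\<dots> = ennreal (c * T)" using \<open>0 \<le> c\<close> by (simp add: ennreal_mult')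
  \<comment> \<open>The bound on the nonnegative integral passes to the Bochner integral even at its
    default value 0, because \<open>c * T\<close> is nonnegative.\<close>
  finally have G_le: "(LINT x:ball 0 r|lborel. ?g x) \<le> c * T"
    unfolding set_lebesgue_integral_def using \<open>0 \<le> c\<close> \<open>0 \<le> T\<close>
    by (intro integral_real_bounded) auto
  have "0 \<le> (LINT x:ball 0 r|lborel. ?g x)"
    unfolding set_lebesgue_integral_def using assms(4,5) by (intro integral_nonneg_AE) auto
  then show "0 \<le> G_fun a p lm lp u r" by (simp add: G_fun_def)
  \<comment> \<open>The scaling that yields the gain: the normalisation of \<open>G_fun\<close>
    times the factor \<open>r powr (- a)\<close> of the surface term is
    \<open>r powr (1 - a)\<close> times the normalisation of \<open>H_fun\<close>.\<close>
  have e: "r powr (- (N + a - 1)) * r powr (- a) = r powr (1 - a) * r powr (- (N + a))"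
    by (simp add: algebra_simps flip: powr_add)
  have "G_fun a p lm lp u r \<le> r powr (- (N + a - 1)) * (c * T)"
    unfolding G_fun_def N_def by (intro mult_left_mono G_le) auto
  also have "\<dots> = c * (2 * (r powr (- (N + a - 1)) * r powr (- a)) * S +
      4 / (1 - a) * r powr (1 - a) * (r powr (- (N + a - 1)) * E))"
    by (simp add: T_def algebra_simps)
  also have "\<dots> = c * r powr (1 - a) * (2 * H_fun a u r + 4 / (1 - a) * D_fun a V r)"
    unfolding e by (simp add: H_fun_def D_fun_def S_def E_def N_def algebra_simps)
  \<comment> \<open>The coefficient 2 is enlarged to \<open>4 / (1 - a)\<close>, possible as
    \<open>-1 < a\<close>, to give both terms the same constant.\<close>
  also have "\<dots> \<le> c * r powr (1 - a) * (4 / (1 - a) * H_fun a u r + 4 / (1 - a) * D_fun a V r)"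
  proof (intro mult_left_mono add_right_mono mult_right_mono)
    show "2 \<le> 4 / (1 - a)" using assms by (simp add: field_simps)
    show "0 \<le> H_fun a u r" using \<open>0 \<le> S\<close> by (simp add: H_fun_def S_def)
  qed (use \<open>0 \<le> c\<close> in auto)
  also have "\<dots> = c * (4 / (1 - a)) * r powr (1 - a) * (H_fun a u r + D_fun a V r)"
    by (simp only: distrib_left[symmetric] mult.assoc mult.left_commute)
  finally show "G_fun a p lm lp u r \<le>
      (lm + lp) * M powr (p - 2) * (4 / (1 - a)) * r powr (1 - a) * (H_fun a u r + D_fun a V r)"
    by (simp only: c_def)
qed

section \<open>Comparison of the two frequency functions\<close>

text \<open>Dividing the bound on \<open>G_fun\<close> by \<open>H_fun\<close> leaves
  \<open>1 + frequency\<close>. Since \<open>G_fun\<close> is nonnegative, the perturbed frequency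
  may replace the frequency on the right; it is the one whose convergence is known.\<close>

lemma perturbed_frequency_close:
  fixes u :: "(real ^ 'n) \<times> real \<Rightarrow> real"
  assumes "-1 < a" "a < 1" "2 \<le> p" "0 \<le> lm" "0 \<le> lp" "0 < r" "r < 1"
    and grad: "has_H1a_gradient a 1 u V"
    and cont: "continuous_on (half_ball 1 \<union> ball 0 1 \<times> {0}) u"
    and M: "\<And>x. norm x < r \<Longrightarrow> \<bar>u (x, 0)\<bar> \<le> M"
  shows "\<bar>perturbed_frequency a p lm lp u V r - frequency a u V r\<bar> \<le>
    2 / p * ((lm + lp) * M powr (p - 2) * (4 / (1 - a))) * r powr (1 - a) *
      (1 + perturbed_frequency a p lm lp u V r)"
proof (cases "H_fun a u r = 0")
  case True
  then show ?thesis
    \<comment> \<open>Division by 0 gives 0, so both frequencies vanish and the right side is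
      nonnegative.\<close>
    using assms by (simp add: perturbed_frequency_def frequency_def)
next
  case False
  define C where "C = (lm + lp) * M powr (p - 2) * (4 / (1 - a))"
  let ?H = "H_fun a u r" and ?D = "D_fun a V r" and ?G = "G_fun a p lm lp u r"
  have "0 \<le> ?H"
    unfolding H_fun_def by (intro mult_nonneg_nonneg half_sphere_integral_nonneg) auto
  with False have "0 < ?H" by simp
  have G: "0 \<le> ?G" "?G \<le> C * r powr (1 - a) * (?H + ?D)"
    using G_fun_bounds[OF assms False] by (simp_all add: C_def)
  have "0 \<le> C" using assms by (simp add: C_def)
  have diff: "perturbed_frequency a p lm lp u V r - frequency a u V r = 2 / p * (?G / ?H)"
    by (simp add: perturbed_frequency_def frequency_def add_divide_distrib)
  have "?G / ?H \<le> C * r powr (1 - a) * (?H + ?D) / ?H"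
    using G(2) \<open>0 < ?H\<close> by (intro divide_right_mono) auto
  also have "\<dots> = C * r powr (1 - a) * (1 + frequency a u V r)"
    using \<open>0 < ?H\<close> by (simp add: frequency_def field_simps)
  also have "\<dots> \<le> C * r powr (1 - a) * (1 + perturbed_frequency a p lm lp u V r)"
    using \<open>0 \<le> C\<close> diff G(1) \<open>0 < ?H\<close> \<open>2 \<le> p\<close>
    by (intro mult_left_mono add_left_mono) (auto simp: diff_eq_eq)
  finally have le: "?G / ?H \<le> C * r powr (1 - a) * (1 + perturbed_frequency a p lm lp u V r)" .
  have "\<bar>2 / p * (?G / ?H)\<bar> = 2 / p * (?G / ?H)"
    using G(1) \<open>0 < ?H\<close> \<open>2 \<le> p\<close> by simp
  also have "\<dots> \<le> 2 / p * (C * r powr (1 - a) * (1 + perturbed_frequency a p lm lp u V r))"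
    using \<open>2 \<le> p\<close> by (intro mult_left_mono le) auto
  finally show ?thesis
    unfolding diff by (simp add: C_def mult.assoc)
qed

theorem proposition3p8:
  fixes a p lm lp k :: real
    and g u :: "(real ^ 'n) \<times> real \<Rightarrow> real"
    and Du :: "(real ^ 'n) \<times> real \<Rightarrow> (real ^ 'n) \<times> real"
  assumes "-1 < a" and "a < 1" and "2 \<le> p" and "0 \<le> lm" and "0 \<le> lp"
    and "g \<in> H1a a 1" and "continuous_on (closure (half_ball 1)) g"
    and "is_solution a p lm lp g u Du"
    and "continuous_on (half_ball 1 \<union> ball 0 1 \<times> {0}) u"
    and "\<exists>z \<in> half_ball 1. u z \<noteq> 0"
    and "(perturbed_frequency a p lm lp u Du \<longlongrightarrow> k) (at_right 0)"
  shows "(frequency a u Du \<longlongrightarrow> k) (at_right 0)"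
proof -
  have grad: "has_H1a_gradient a 1 u Du"
    using assms(8) by (simp add: is_solution_def)
  \<comment> \<open>The radius 1/2 gives a compact part of the open flat ball, so one bound
    \<open>M\<close> serves all \<open>r < 1/2\<close>.\<close>
  have "continuous_on (cball 0 (1/2)) (\<lambda>x. u (x, 0))"
    by (intro continuous_on_compose2[OF assms(9)] continuous_intros) auto
  then have "bounded ((\<lambda>x. u (x, 0)) ` cball 0 (1/2))"
    by (intro compact_imp_bounded compact_continuous_image) auto
  then obtain M where "\<forall>t \<in> (\<lambda>x. u (x, 0)) ` cball 0 (1/2). norm t \<le> M"
    unfolding bounded_iff ..
  then have M: "\<bar>u (x, 0)\<bar> \<le> M" if "norm x \<le> 1/2" for x
    using that by simp
  define c where "c = 2 / p * ((lm + lp) * M powr (p - 2) * (4 / (1 - a)))"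
  let ?P = "perturbed_frequency a p lm lp u Du"
  have "((\<lambda>r. r powr (1 - a)) \<longlongrightarrow> 0) (at_right 0)"
    using assms(2) by (intro tendsto_zero_powrI tendsto_ident_at tendsto_const)
      (auto simp: eventually_at_filter)
  \<comment> \<open>Convergence of the perturbed frequency is used here: the last factor tends to
    \<open>1 + k\<close>, hence the product tends to 0.\<close>
  then have "((\<lambda>r. c * r powr (1 - a) * (1 + ?P r)) \<longlongrightarrow> c * 0 * (1 + k)) (at_right 0)"
    by (intro tendsto_intros assms(11))
  then have lim0: "((\<lambda>r. c * r powr (1 - a) * (1 + ?P r)) \<longlongrightarrow> 0) (at_right 0)"
    by simp
  have "\<forall>\<^sub>F r in at_right 0. norm (?P r - frequency a u Du r) \<le> c * r powr (1 - a) * (1 + ?P r)"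
  proof (rule eventually_at_rightI[of 0 "1/2"])
    fix r :: real assume "r \<in> {0<..<1/2}"
    then show "norm (?P r - frequency a u Du r) \<le> c * r powr (1 - a) * (1 + ?P r)"
      using perturbed_frequency_close[OF assms(1-5) _ _ grad assms(9), of r M] M
      by (simp add: c_def)
  qed simp
  then have "((\<lambda>r. ?P r - frequency a u Du r) \<longlongrightarrow> 0) (at_right 0)"
    by (rule Lim_null_comparison[OF _ lim0])
  from tendsto_diff[OF assms(11) this] show ?thesis
    by simp
qed

end
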